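(* Let $n\ge 2$ and $1<p,q<\infty$. Let $U$ and $v$ be non-negative measurable functions on $\mathbb{S}^{n-1}$ and $\mathbb{R}^n$, respectively. Assume that the weighted restriction inequality $$\left(\int_{\mathbb{S}^{n-1}}|\widehat f(\omega)|^q\,U(\omega)\,d\sigma(\omega)\right)^{1/q}\le C\left(\int_{\mathbb{R}^n}|f(x)|^p v(x)\,dx\right)^{1/p}$$ holds for all $f\in C_0^\infty(\mathbb{R}^n)$ with a constant $C$ independent of $f$, and that $U^{1-q'}\in L^1(\mathbb{S}^{n-1})$. Then $$\int_{\mathbb{R}^n}v^{1-p'}(x)\,|j_{n/2-1}(|x|)|^{p'}\,dx<\infty .$$
   Context: The Fourier transform is $\widehat f(\xi)=\int_{\mathbb{R}^n}e^{ix\xi}f(x)\,dx$. $d\sigma$ is the induced Lebesgue (surface) measure on the unit sphere $\mathbb{S}^{n-1}$. For an exponent $r$, $r'=r/(r-1)$. $j_\alpha(t)=\Gamma(\alpha+1)(t/2)^{-\alpha}J_\alpha(t)$ is the normalized Bessel function, where $J_\alpha$ is the Bessel function of the first kind of order $\alpha$.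
   Formalization: The formal theorem also assumes that almost every point has a ball on which v is integrable; without this, a weight v integrable on no ball makes the inequality hold vacuously and the conclusion can fail. *)

theory Defs
  imports "HOL-Analysis.Analysis"
begin

(* The surface measure of a Borel set A in the unit sphere is n times the Lebesgue measure of the
   open cone {r w | w : A, 0 < r < 1}, cf. lemma emeasure_sphere_measure; this is the normalisation
   of polar coordinates dx = r^(n-1) dr d(sigma).  The completion is taken so that measurability of
   a function on the sphere means Lebesgue (not just Borel) measurability. *)

definition sphere_measure :: "'a::euclidean_space measure" where
  "sphere_measure = completion (scale_measure (of_nat DIM('a))
     (distr (restrict_space lborel (ball 0 1 - {0})) (restrict_space borel (sphere 0 1))
        (\<lambda>x. x /\<^sub>R norm x)))"

lemma space_sphere_measure: "space sphere_measure = sphere (0::'a::euclidean_space) 1"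
  by (simp add: sphere_measure_def space_scale_measure space_restrict_space)

lemma emeasure_sphere_measure:
  fixes A :: "'a::euclidean_space set"
  assumes A: "A \<in> sets borel" "A \<subseteq> sphere 0 1"
  shows "emeasure sphere_measure A =
    of_nat DIM('a) * emeasure lborel {r *\<^sub>R w | r w. w \<in> A \<and> 0 < r \<and> r < 1}"
proof -
  let ?B = "ball (0::'a) 1 - {0}"
  let ?f = "\<lambda>x::'a. x /\<^sub>R norm x"
  have f: "?f \<in> restrict_space lborel ?B \<rightarrow>\<^sub>M restrict_space borel (sphere 0 1)"
    by (rule measurable_restrict_space3) (auto simp: space_restrict_space)
  have "{r *\<^sub>R w | r w. w \<in> A \<and> 0 < r \<and> r < 1} = ?f -` A \<inter> ?B" (is "?L = ?R")
  proof (intro equalityI subsetI)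
    fix x assume "x \<in> ?L"
    then obtain r w where "x = r *\<^sub>R w" "w \<in> A" "0 < r" "r < 1" by blast
    moreover from this have "norm w = 1" using A(2) by auto
    ultimately show "x \<in> ?R" by auto
  next
    fix x assume "x \<in> ?R"
    then have "x = norm x *\<^sub>R ?f x" "?f x \<in> A" "0 < norm x" "norm x < 1" by auto
    then show "x \<in> ?L" by blast
  qed
  moreover have "A \<in> sets (restrict_space borel (sphere 0 1))"
    using A by (auto simp: sets_restrict_space)
  ultimately show ?thesis
    unfolding sphere_measure_def
    by (simp add: emeasure_distr[OF f] space_restrict_space emeasure_restrict_space
        main_part_sets)
qed

lemma emeasure_sphere_measure_UNIV:
  "emeasure sphere_measure (sphere (0::'a::euclidean_space) 1) =
     ennreal (DIM('a) * unit_ball_vol DIM('a))"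
proof -
  have "{r *\<^sub>R w | r w. w \<in> sphere (0::'a) 1 \<and> 0 < r \<and> r < 1} = ball 0 1 - {0}" (is "?L = ?R")
  proof (intro equalityI subsetI)
    fix x :: 'a assume "x \<in> ?R"
    then have "x = norm x *\<^sub>R (x /\<^sub>R norm x)" "x /\<^sub>R norm x \<in> sphere 0 1" "0 < norm x" "norm x < 1"
      by auto
    then show "x \<in> ?L" by blast
  qed auto
  moreover have "emeasure lborel (ball (0::'a) 1 - {0}) = emeasure lborel (ball (0::'a) 1)"
    by (rule emeasure_Diff_null_set) auto
  ultimately show ?thesis
    by (subst emeasure_sphere_measure)
       (auto simp: emeasure_ball ennreal_mult simp flip: ennreal_of_nat_eq_real_of_nat)
qed

(* Real powers of extended non-negative numbers.  In contrast to powr on the reals,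
   a negative power of 0 is infinity, so weights that vanish somewhere are treated correctly. *)

definition epowr :: "ennreal \<Rightarrow> real \<Rightarrow> ennreal"  (infixr "epowr" 80) where
  "x epowr a =
     (if a = 0 then 1
      else if x = 0 then (if a < 0 then \<infinity> else 0)
      else if x = \<infinity> then (if a < 0 then 0 else \<infinity>)
      else ennreal (enn2real x powr a))"

definition conj_exponent :: "real \<Rightarrow> real" where
  "conj_exponent r = r / (r - 1)"

primrec continuously_differentiable ::
    "nat \<Rightarrow> ('a::real_normed_vector \<Rightarrow> 'b::real_normed_vector) \<Rightarrow> bool" where
  "continuously_differentiable 0 f \<longleftrightarrow> continuous_on UNIV f"
| "continuously_differentiable (Suc k) f \<longleftrightarrow>
     (\<forall>x. f differentiable (at x)) \<and>
     (\<forall>u. continuously_differentiable k (\<lambda>x. frechet_derivative f (at x) u))"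

definition test_functions :: "('a::euclidean_space \<Rightarrow> complex) set" where
  "test_functions =
     {f. (\<forall>k. continuously_differentiable k f) \<and> compact (closure {x. f x \<noteq> 0})}"

definition fourier :: "('a::euclidean_space \<Rightarrow> complex) \<Rightarrow> 'a \<Rightarrow> complex" where
  "fourier f \<xi> = (LINT x|lebesgue. exp (\<i> * complex_of_real (x \<bullet> \<xi>)) * f x)"

(* Bessel function of the first kind for t > 0; rGamma is the reciprocal of Gamma. *)

definition bessel_J :: "real \<Rightarrow> real \<Rightarrow> real" where
  "bessel_J a t =
     (\<Sum>m. (-1) ^ m * rGamma (real m + a + 1) / fact m * (t / 2) powr (2 * real m + a))"

(* The value 1 at t = 0 is the limit of the normalised Bessel function as t tends to 0. *)

definition bessel_j :: "real \<Rightarrow> real \<Rightarrow> real" where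
  "bessel_j a t =
     (if t = 0 then 1 else Gamma (a + 1) * (t / 2) powr (- a) * bessel_J a t)"

end

theory Submission
  imports Defs "HOL-Probability.Distributions"
begin

text \<open>
  Integrating \<open>\<integral> f(x) exp (i x \<omega>) dx\<close> over the sphere gives \<open>\<bar>S\<bar> \<integral> f(x) j(\<bar>x\<bar>) dx\<close>, because the
  Fourier transform of the surface measure is a multiple of \<open>j\<^bsub>n/2-1\<^esub>\<close>.  By Hoelder's inequality
  on the sphere and the restriction inequality, \<open>f \<mapsto> \<integral> f(x) j(\<bar>x\<bar>) dx\<close> is therefore bounded on test
  functions in the norm of \<open>L\<^sup>p(v)\<close>, so by duality \<open>j / v\<close> lies in \<open>L\<^bsup>p'\<^esup>(v)\<close>, which is the claim.
  Duality needs test functions to be dense, which holds on compact sets where \<open>v\<close> is integrable; the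
  hypothesis that almost every point has a ball on which \<open>v\<close> is integrable lets such sets exhaust
  the space.

  For the transform of the surface measure, the moments \<open>\<integral> (x \<omega>)\<^sup>2\<^sup>m d\<sigma>\<close> are read off from Gaussian
  integrals: in polar coordinates they are the quotient of the moments of \<open>x y\<close> and of \<open>\<bar>y\<bar>\<close> under
  \<open>exp (-\<bar>y\<bar>\<^sup>2)\<close>, and these have explicit generating functions by translating and scaling \<open>y\<close>.
\<close>

section \<open>Smooth functions of compact support\<close>

text \<open>The case \<open>k = 0\<close> is the classical smooth function that is flat at the
  origin. The powers in the denominator are carried along because differentiation produces
  them.\<close>

definition flat :: "nat \<Rightarrow> real \<Rightarrow> real" where
  "flat k t = (if 0 < t then exp (- 1 / t) / t ^ k else 0)"

lemma flat_nonneg: "0 \<le> flat k t"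
  by (simp add: flat_def)

lemma flat_pos_iff: "0 < flat k t \<longleftrightarrow> 0 < t"
  by (simp add: flat_def)

lemma flat_tendsto_0: "(flat k \<longlongrightarrow> 0) (at 0)"
proof -
  have "((\<lambda>x::real. x ^ k / exp x) \<longlongrightarrow> 0) at_top"
    by (rule tendsto_power_div_exp_0)
  then have "((\<lambda>t::real. inverse t ^ k / exp (inverse t)) \<longlongrightarrow> 0) (at_right 0)"
    by (rule filterlim_compose[OF _ filterlim_inverse_at_top_right])
  moreover have "\<forall>\<^sub>F t in at_right 0. inverse t ^ k / exp (inverse t) = flat k t"
    by (auto simp: eventually_at_filter flat_def exp_minus field_simps)
  ultimately have "(flat k \<longlongrightarrow> 0) (at_right 0)"
    by (rule Lim_transform_eventually)
  moreover have "(flat k \<longlongrightarrow> 0) (at_left 0)"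
    by (rule tendsto_eventually) (auto simp: eventually_at_filter flat_def)
  ultimately show ?thesis
    by (simp add: filterlim_at_split)
qed

text \<open>The derivative stays in the span of the family, so smoothness of all orders becomes a
  closure property. At 0 the difference quotient of \<open>flat k\<close> is
  \<open>flat (k + 1)\<close>, which tends to 0.\<close>

lemma flat_has_derivative:
  "(flat k has_real_derivative flat (k + 2) t - real k * flat (k + 1) t) (at t)"
proof (cases t "0::real" rule: linorder_cases)
  case less
  have "((\<lambda>_. 0) has_real_derivative 0) (at t)" by simp
  then have "(flat k has_real_derivative 0) (at t)"
    by (rule has_field_derivative_transform_within_open[where S = "{..<0}"])
      (use less in \<open>auto simp: flat_def\<close>)
  then show ?thesis using less by (simp add: flat_def)
next
  case equal
  have "\<forall>\<^sub>F h in at 0. flat (k + 1) h = (flat k (0 + h) - flat k 0) / h"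
    by (auto simp: eventually_at_filter flat_def)
  with flat_tendsto_0[of "k + 1"] have "((\<lambda>h. (flat k (0 + h) - flat k 0) / h) \<longlongrightarrow> 0) (at 0)"
    by (rule Lim_transform_eventually)
  then show ?thesis using equal by (simp add: DERIV_def flat_def)
next
  case greater
  have exp: "((\<lambda>t. exp (- 1 / t)) has_real_derivative exp (- 1 / t) / t\<^sup>2) (at t)"
    using greater by (auto intro!: derivative_eq_intros simp: power2_eq_square)
  have pow: "((\<lambda>t. t ^ k) has_real_derivative real k * t ^ k / t) (at t)"
    using DERIV_pow[of k t] greater by (cases k) auto
  have "((\<lambda>t. exp (- 1 / t) / t ^ k) has_real_derivative
      flat (k + 2) t - real k * flat (k + 1) t) (at t)"
    by (rule DERIV_cong[OF DERIV_divide[OF exp pow]])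
      (use greater in \<open>auto simp: flat_def field_simps power2_eq_square\<close>)
  then show ?thesis
    by (rule has_field_derivative_transform_within_open[where S = "{0<..}"])
      (use greater in \<open>auto simp: flat_def\<close>)
qed

text \<open>A class generated by rules, so that closure under directional derivatives is provable by
  induction. It contains the polynomials, for density, and through the last rule functions that are
  non-zero exactly where the squared distance to \<open>a\<close> is below \<open>r\<close>, for
  cutoffs.\<close>

inductive smooth_alg :: "('a::euclidean_space \<Rightarrow> real) \<Rightarrow> bool" where
  linear: "bounded_linear f \<Longrightarrow> smooth_alg f"
| const: "smooth_alg (\<lambda>x. c)"
| add: "smooth_alg f \<Longrightarrow> smooth_alg g \<Longrightarrow> smooth_alg (\<lambda>x. f x + g x)"
| mult: "smooth_alg f \<Longrightarrow> smooth_alg g \<Longrightarrow> smooth_alg (\<lambda>x. f x * g x)"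
| flat: "smooth_alg (\<lambda>x. flat k (r - (x - a) \<bullet> (x - a)))"

lemma smooth_alg_polynomial: "real_polynomial_function f \<Longrightarrow> smooth_alg f"
  by (induction rule: real_polynomial_function.induct) (auto intro: smooth_alg.intros)

lemma smooth_alg_sum:
  "(\<And>i. i \<in> I \<Longrightarrow> smooth_alg (f i)) \<Longrightarrow> smooth_alg (\<lambda>x. \<Sum>i\<in>I. f i x)"
  by (induction I rule: infinite_finite_induct) (auto intro: smooth_alg.intros)

lemma smooth_alg_derivative:
  assumes "smooth_alg f"
  obtains F where "\<And>x. (f has_derivative F x) (at x)" "\<And>u. smooth_alg (\<lambda>x. F x u)"
proof -
  have "\<exists>F. (\<forall>x. (f has_derivative F x) (at x)) \<and> (\<forall>u. smooth_alg (\<lambda>x. F x u))"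
    using assms
  proof induction
    case (linear f)
    then show ?case
      by (intro exI[of _ "\<lambda>_. f"]) (auto intro: bounded_linear_imp_has_derivative smooth_alg.const)
  next
    case (const c)
    show ?case by (intro exI[of _ "\<lambda>_ _. 0"]) (auto intro: smooth_alg.const)
  next
    case (add f g)
    then obtain F G where FG: "\<forall>x. (f has_derivative F x) (at x)" "\<forall>u. smooth_alg (\<lambda>x. F x u)"
      "\<forall>x. (g has_derivative G x) (at x)" "\<forall>u. smooth_alg (\<lambda>x. G x u)"
      by auto
    show ?case
      by (intro exI[of _ "\<lambda>x u. F x u + G x u"]) (use FG in \<open>auto intro!: smooth_alg.add has_derivative_add\<close>)
  next
    case (mult f g)
    then obtain F G where FG: "\<forall>x. (f has_derivative F x) (at x)" "\<forall>u. smooth_alg (\<lambda>x. F x u)"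
      "\<forall>x. (g has_derivative G x) (at x)" "\<forall>u. smooth_alg (\<lambda>x. G x u)"
      by auto
    show ?case
      by (intro exI[of _ "\<lambda>x u. f x * G x u + F x u * g x"])
        (use FG mult in \<open>auto intro!: smooth_alg.add smooth_alg.mult has_derivative_mult\<close>)
  next
    case (flat k r a)
    define q where "q = (\<lambda>x. r - (x - a) \<bullet> (x - a))"
    \<comment> \<open>The chain rule, with differences written as sums and constant multiples so
      that the introduction rules of \<open>smooth_alg\<close> apply to it literally.\<close>
    define F where "F = (\<lambda>x u. (flat (k + 2) (q x) + (- real k) * flat (k + 1) (q x)) *
      ((-2) * (u \<bullet> x + - (u \<bullet> a))))"
    have q: "(q has_derivative (\<lambda>u. (-2) * (u \<bullet> x + - (u \<bullet> a)))) (at x)" for x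
      unfolding q_def
      by (auto intro!: derivative_eq_intros simp: algebra_simps inner_commute)
    have "((\<lambda>x. flat k (q x)) has_derivative F x) (at x)" for x
      unfolding F_def using has_derivative_compose[OF q, of "flat k", OF
          flat_has_derivative[unfolded has_field_derivative_def]]
      by simp
    moreover have "smooth_alg (\<lambda>x. F x u)" for u
      unfolding F_def q_def
      by (intro smooth_alg.intros bounded_linear_inner_right)
    ultimately show ?case unfolding q_def by blast
  qed
  then show thesis using that by blast
qed

lemma continuous_on_smooth_alg: "smooth_alg f \<Longrightarrow> continuous_on S f"
  by (metis smooth_alg_derivative continuous_at_imp_continuous_on has_derivative_continuous)

text \<open>Directional derivatives of members are members again, so the recursion in
  \<open>continuously_differentiable\<close> is matched by induction on \<open>k\<close> with
  \<open>f\<close> arbitrary.\<close>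

lemma continuously_differentiable_smooth_alg:
  "smooth_alg f \<Longrightarrow> continuously_differentiable k (\<lambda>x. complex_of_real (f x))"
proof (induction k arbitrary: f)
  case 0
  then show ?case by (auto intro!: continuous_intros continuous_on_smooth_alg)
next
  case (Suc k)
  obtain F where F: "\<And>x. (f has_derivative F x) (at x)" "\<And>u. smooth_alg (\<lambda>x. F x u)"
    using smooth_alg_derivative[OF Suc.prems] by blast
  have D: "((\<lambda>x. complex_of_real (f x)) has_derivative (\<lambda>u. complex_of_real (F x u))) (at x)" for x
    by (rule has_derivative_of_real[OF F(1)])
  have "frechet_derivative (\<lambda>x. complex_of_real (f x)) (at x) = (\<lambda>u. complex_of_real (F x u))" for x
    using frechet_derivative_at[OF D] by simp
  then show ?case
    using D Suc.IH[OF F(2)] by (auto simp: differentiable_def)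
qed

lemma smooth_alg_test_function:
  assumes "smooth_alg f" "bounded {x. f x \<noteq> 0}"
  shows "(\<lambda>x. complex_of_real (f x)) \<in> test_functions"
  using assms continuously_differentiable_smooth_alg[of f]
  by (auto simp: test_functions_def compact_eq_bounded_closed)

section \<open>The Fourier transform of the surface measure\<close>

text \<open>The generating functions below are known only for positive arguments. Convergence at
  \<open>r / 2\<close> makes the difference series continuous at 0; once the lower coefficients
  vanish, dividing by \<open>u ^ k\<close> exposes the next one as a limit from the right of the
  zero function.\<close>

lemma powser_unique_right:
  fixes a b :: "nat \<Rightarrow> real"
  assumes r: "0 < r"
    and a: "\<And>u. 0 < u \<Longrightarrow> u < r \<Longrightarrow> (\<lambda>m. a m * u ^ m) sums f u"
    and b: "\<And>u. 0 < u \<Longrightarrow> u < r \<Longrightarrow> (\<lambda>m. b m * u ^ m) sums f u"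
  shows "a = b"
proof -
  define c where "c = (\<lambda>m. a m - b m)"
  have c: "(\<lambda>m. c m * u ^ m) sums 0" if "0 < u" "u < r" for u
    using sums_diff[OF a[OF that] b[OF that]] by (simp add: c_def algebra_simps)
  have "c k = 0" for k
  proof (induction k rule: less_induct)
    case (less k)
    have z: "(\<lambda>m. c (m + k) * u ^ m) sums 0" if u: "0 < u" "u < r" for u
    proof -
      have "(\<lambda>m. c (m + k) * u ^ (m + k)) sums (0 - (\<Sum>i<k. c i * u ^ i))"
        using sums_split_initial_segment[OF c[OF u], of k] by simp
      then have "(\<lambda>m. c (m + k) * u ^ (m + k)) sums 0" using less by simp
      moreover have "c (m + k) * u ^ (m + k) / u ^ k = c (m + k) * u ^ m" for m
        using u by (simp add: power_add)
      ultimately show ?thesis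
        using sums_divide[of "\<lambda>m. c (m + k) * u ^ (m + k)" 0 "u ^ k"] by simp
    qed
    define F where "F = (\<lambda>u. \<Sum>m. c (m + k) * u ^ m)"
    have "summable (\<lambda>m. c (m + k) * (r / 2) ^ m)"
      using sums_summable[OF z[of "r / 2"]] r by simp
    then have "(\<lambda>m. c (m + k) * u ^ m) sums F u" if "norm u < r / 2" for u
    proof -
      have "norm u < norm (r / 2)"
        using r that unfolding real_norm_def by linarith
      with \<open>summable _\<close> show ?thesis
        unfolding F_def by (intro summable_sums[OF powser_inside])
    qed
    then have "(F \<longlongrightarrow> c (0 + k)) (at 0)"
      using r by (intro powser_limit_0[of "r / 2"]) auto
    then have "(F \<longlongrightarrow> c k) (at_right 0)"
      by (simp add: filterlim_at_split)
    moreover have "\<forall>\<^sub>F u in at_right 0. 0 = F u"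
      using r z by (auto simp: eventually_at_right F_def sums_iff intro!: exI[of _ r])
    then have "(F \<longlongrightarrow> 0) (at_right 0)"
      by (rule Lim_transform_eventually[OF tendsto_const])
    ultimately show ?case
      by (intro tendsto_unique) auto
  qed
  then show ?thesis by (auto simp: c_def)
qed

section \<open>Integration over the sphere and polar coordinates\<close>

lemma measurable_sphere_measure:
  assumes "g \<in> borel \<rightarrow>\<^sub>M N"
  shows "g \<in> (sphere_measure :: 'a::euclidean_space measure) \<rightarrow>\<^sub>M N"
proof -
  have "g \<in> restrict_space borel (sphere 0 1) \<rightarrow>\<^sub>M N"
    using assms by (rule measurable_restrict_space1)
  then show ?thesis
    unfolding sphere_measure_def by (intro measurable_completion) simp
qed

lemma nn_integral_sphere_measure:
  fixes g :: "'a::euclidean_space \<Rightarrow> ennreal"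
  assumes [measurable]: "g \<in> borel_measurable borel"
  shows "(\<integral>\<^sup>+w. g w \<partial>sphere_measure) =
    of_nat DIM('a) * (\<integral>\<^sup>+x. g (x /\<^sub>R norm x) * indicator (ball 0 1) x \<partial>lborel)"
proof -
  let ?B = "ball (0::'a) 1 - {0}"
  let ?f = "\<lambda>x::'a. x /\<^sub>R norm x"
  have f: "?f \<in> restrict_space lborel ?B \<rightarrow>\<^sub>M restrict_space borel (sphere 0 1)"
    by (rule measurable_restrict_space3) (auto simp: space_restrict_space)
  have g: "g \<in> borel_measurable (restrict_space borel (sphere 0 1))"
    by (rule measurable_restrict_space1) simp
  have "(\<integral>\<^sup>+w. g w \<partial>sphere_measure) =
      of_nat DIM('a) * (\<integral>\<^sup>+x. g (?f x) * indicator ?B x \<partial>lborel)"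
    using f g unfolding sphere_measure_def
    by (simp add: nn_integral_completion nn_integral_scale_measure nn_integral_distr
        nn_integral_restrict_space)
  also have "(\<integral>\<^sup>+x. g (?f x) * indicator ?B x \<partial>lborel) =
      (\<integral>\<^sup>+x. g (?f x) * indicator (ball 0 1) x \<partial>lborel)"
    using AE_lborel_singleton[of "0::'a"]
    by (intro nn_integral_cong_AE) (auto elim!: eventually_mono split: split_indicator)
  finally show ?thesis .
qed

lemma finite_measure_sphere_measure:
  "finite_measure (sphere_measure :: 'a::euclidean_space measure)"
  by (rule finite_measureI) (simp add: space_sphere_measure emeasure_sphere_measure_UNIV)

lemma nn_integral_lborel_scale:
  fixes F :: "'a::euclidean_space \<Rightarrow> ennreal"
  assumes [measurable]: "F \<in> borel_measurable borel" and "0 < s"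
  shows "(\<integral>\<^sup>+x. F x \<partial>lborel) = ennreal (s ^ DIM('a)) * (\<integral>\<^sup>+x. F (s *\<^sub>R x) \<partial>lborel)"
  using assms(2)
  by (subst lborel_affine[of s 0])
    (auto simp: nn_integral_density nn_integral_distr nn_integral_cmult)

text \<open>Both sides, as functions of the radial set, are measures on the half line that scale like
  \<open>r ^ n\<close>.\<close>

lemma nn_integral_polar:
  fixes g :: "'a::euclidean_space \<Rightarrow> ennreal" and h :: "real \<Rightarrow> ennreal"
  assumes [measurable]: "g \<in> borel_measurable borel" "h \<in> borel_measurable borel"
    and fin: "(\<integral>\<^sup>+w. g w \<partial>sphere_measure) < \<infinity>"
  shows "emeasure sphere_measure (sphere (0::'a) 1) * (\<integral>\<^sup>+x. h (norm x) * g (x /\<^sub>R norm x) \<partial>lborel)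
    = (\<integral>\<^sup>+w. g w \<partial>sphere_measure) * (\<integral>\<^sup>+x. h (norm (x::'a)) \<partial>lborel)"
proof -
  \<comment> \<open>\<open>M g\<close> is the radial law of the density
    \<open>g (x / norm x)\<close>, and \<open>K g\<close> is its distribution function.\<close>
  define K where "K = (\<lambda>g::'a \<Rightarrow> ennreal. \<lambda>s. \<integral>\<^sup>+x. g (x /\<^sub>R norm x) * indicator (ball 0 s) x \<partial>lborel)"
  define M where "M = (\<lambda>g::'a \<Rightarrow> ennreal. distr (density lborel (\<lambda>x. g (x /\<^sub>R norm x))) borel norm)"
  \<comment> \<open>The angular factor is homogeneous of degree 0, so dilation by \<open>s\<close>
    contributes only the Jacobian.\<close>
  have K: "K g s = ennreal (s ^ DIM('a)) * K g 1"
    if [measurable]: "g \<in> borel_measurable borel" and s: "0 < s" for g s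
  proof -
    have eq: "g ((s *\<^sub>R x) /\<^sub>R norm (s *\<^sub>R x)) * indicator (ball 0 s) (s *\<^sub>R x) =
        g (x /\<^sub>R norm x) * indicator (ball 0 1) x" for x
      using s by (auto split: split_indicator simp: field_simps)
    have "(\<lambda>x. g (x /\<^sub>R norm x) * indicator (ball 0 s) x) \<in> borel_measurable borel"
      by (intro borel_measurable_times_ennreal borel_measurable_indicator) simp_all
    from nn_integral_lborel_scale[OF this s] show ?thesis
      unfolding K_def eq .
  qed
  have K0: "K g s = 0" if "s \<le> 0" for g s
    unfolding K_def by (subst ball_empty[OF that]) simp
  have M: "emeasure (M g) {..<s} = K g s"
    if [measurable]: "g \<in> borel_measurable borel" for g s
  proof -
    have "norm -` {..<s} = ball (0::'a) s" by auto
    then show ?thesis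
      by (simp add: M_def K_def emeasure_distr emeasure_density)
  qed
  have nnM: "(\<integral>\<^sup>+r. h r \<partial>M g) = (\<integral>\<^sup>+x. h (norm x) * g (x /\<^sub>R norm x) \<partial>lborel)"
    if [measurable]: "g \<in> borel_measurable borel" for g
    by (simp add: M_def nn_integral_distr nn_integral_density mult.commute)
  have sph: "(\<integral>\<^sup>+w. g w \<partial>sphere_measure) = of_nat DIM('a) * K g 1"
    if "g \<in> borel_measurable borel" for g
    using nn_integral_sphere_measure[OF that] by (simp add: K_def)
  have sph1: "emeasure sphere_measure (sphere (0::'a) 1) = of_nat DIM('a) * K (\<lambda>_. 1) 1"
    using sph[of "\<lambda>_. 1"] by (simp add: space_sphere_measure)
  have fin1: "emeasure sphere_measure (sphere (0::'a) 1) < \<infinity>"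
    by (simp add: emeasure_sphere_measure_UNIV)
  have *: "emeasure sphere_measure (sphere (0::'a) 1) * K g s =
      (\<integral>\<^sup>+w. g w \<partial>sphere_measure) * K (\<lambda>_. 1) s" for s
    using K[of g s] K[of "\<lambda>_. 1" s]
    by (cases "0 < s") (simp_all add: K0 sph sph1 mult_ac)
  \<comment> \<open>Cross-multiplying avoids division in \<open>ennreal\<close>. The two measures
    agree on the intervals below \<open>s\<close>, an intersection-stable generator, and
    \<open>fin\<close> makes the exhausting intervals have finite mass.\<close>
  have "scale_measure (emeasure sphere_measure (sphere (0::'a) 1)) (M g) =
      scale_measure (\<integral>\<^sup>+w. g w \<partial>sphere_measure) (M (\<lambda>_. 1))"
  proof (rule measure_eqI_generator_eq[where E = "range lessThan" and \<Omega> = UNIV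
        and A = "\<lambda>i. {..<real i}"])
    show "Int_stable (range (lessThan :: real \<Rightarrow> _))"
    proof (rule Int_stableI, safe)
      fix a b :: real
      have "{..<a} \<inter> {..<b} = {..<min a b}" by auto
      then show "{..<a} \<inter> {..<b} \<in> range lessThan" by simp
    qed
    show "(\<Union>i. {..<real i}) = UNIV"
      using reals_Archimedean2 by auto
    fix i
    have "K g (real i) < \<infinity>"
    proof (cases i)
      case (Suc j)
      then show ?thesis
        using fin K[of g "real i"] by (auto simp: sph ennreal_mult_less_top ennreal_mult_eq_top_iff less_top)
    qed (simp add: K0)
    then show "emeasure (scale_measure (emeasure sphere_measure (sphere (0::'a) 1)) (M g)) {..<real i} \<noteq> \<infinity>"
      using fin1 by (auto simp: M ennreal_mult_eq_top_iff)
    show "sets (scale_measure (emeasure sphere_measure (sphere (0::'a) 1)) (M g)) =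
        sigma_sets UNIV (range lessThan)"
      by (simp add: M_def borel_Iio)
    show "sets (scale_measure (\<integral>\<^sup>+w. g w \<partial>sphere_measure) (M (\<lambda>_. 1))) =
        sigma_sets UNIV (range lessThan)"
      by (simp add: M_def borel_Iio)
  qed (auto simp: M *)
  then have "(\<integral>\<^sup>+r. h r \<partial>scale_measure (emeasure sphere_measure (sphere (0::'a) 1)) (M g)) =
      (\<integral>\<^sup>+r. h r \<partial>scale_measure (\<integral>\<^sup>+w. g w \<partial>sphere_measure) (M (\<lambda>_. 1)))"
    by simp
  moreover have "h \<in> borel_measurable (M g)" for g
    by (simp add: M_def)
  ultimately show ?thesis
    by (simp add: nn_integral_scale_measure nnM)
qed

section \<open>Radial and directional moments of the Gaussian\<close>

definition gauss :: "'a::euclidean_space \<Rightarrow> real" where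
  "gauss x = exp (- (norm x)\<^sup>2)"

lemma gauss_pos: "0 < gauss x" by (simp add: gauss_def)

lemma measurable_gauss [measurable]: "gauss \<in> borel_measurable borel"
  unfolding gauss_def by measurable

text \<open>Kept as a symbol since it occurs in both kinds of moments and cancels from their
  quotient.\<close>

definition gauss_mass :: "'a::euclidean_space itself \<Rightarrow> real" where
  "gauss_mass _ = enn2real (\<integral>\<^sup>+x. ennreal (gauss (x::'a)) \<partial>lborel)"

text \<open>The Gaussian factors over the coordinates, each contributing \<open>sqrt pi\<close>; the
  resulting finiteness ensures that \<open>enn2real\<close> loses nothing.\<close>

lemma nn_integral_gauss:
  "(\<integral>\<^sup>+x. ennreal (gauss (x::'a::euclidean_space)) \<partial>lborel) = ennreal (gauss_mass TYPE('a))"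
proof -
  have "has_bochner_integral lborel (\<lambda>x::real. exp (- x\<^sup>2)) (2 *\<^sub>R (sqrt pi / 2))"
    by (rule has_bochner_integral_even_function[OF gaussian_moment_0]) simp
  then have "(\<integral>\<^sup>+x. ennreal (exp (- x\<^sup>2)) \<partial>lborel) = ennreal (sqrt pi)"
    by (subst nn_integral_eq_integral) (auto simp: has_bochner_integral_iff)
  moreover have "gauss x = (\<Prod>b\<in>Basis. exp (- (x \<bullet> b)\<^sup>2))" for x :: 'a
    unfolding gauss_def power2_norm_eq_inner euclidean_inner[of x x]
    by (simp add: exp_sum[symmetric] sum_negf power2_eq_square)
  ultimately have "(\<integral>\<^sup>+x. ennreal (gauss (x::'a)) \<partial>lborel) = (\<Prod>b\<in>(Basis::'a set). ennreal (sqrt pi))"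
    using nn_integral_lborel_prod[of "\<lambda>b::'a. \<lambda>t. ennreal (exp (- t\<^sup>2))"]
    by (simp add: prod_ennreal)
  then have "(\<integral>\<^sup>+x. ennreal (gauss (x::'a)) \<partial>lborel) < \<infinity>"
    by (simp add: ennreal_power power_less_top_ennreal)
  then show ?thesis
    by (simp add: gauss_mass_def)
qed

lemma gauss_mass_pos: "0 < gauss_mass TYPE('a::euclidean_space)"
proof (rule ccontr)
  assume "\<not> ?thesis"
  then have "(\<integral>\<^sup>+x. ennreal (gauss (x::'a)) \<partial>lborel) = 0"
    by (simp add: nn_integral_gauss ennreal_neg)
  then have "AE x in lborel. gauss (x::'a) \<le> 0"
    by (subst (asm) nn_integral_0_iff_AE) (auto simp: ennreal_eq_0_iff)
  then have "AE x in (lborel :: 'a measure). False"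
    by (rule eventually_mono) (use gauss_pos not_le in blast)
  then show False by (simp add: trivial_limit_def[symmetric] ae_filter_eq_bot_iff)
qed


text \<open>Brings a generating function from \<open>ennreal\<close> to the reals: a finite total
  with positive coefficients forces every moment \<open>R m\<close> to be finite.\<close>

lemma ennreal_sums_of_suminf:
  assumes a: "\<And>m. 0 < a m" and S: "(\<Sum>m. ennreal (a m) * R m) = ennreal S" "0 \<le> S"
  shows "R m = ennreal (enn2real (R m))" and "(\<lambda>m. a m * enn2real (R m)) sums S"
proof -
  have R: "R m = ennreal (enn2real (R m))" for m
  proof -
    have "ennreal (a m) * R m \<le> (\<Sum>m. ennreal (a m) * R m)"
      using sum_le_suminf[of "\<lambda>m. ennreal (a m) * R m" "{m}"] by simp
    also have "\<dots> < \<infinity>" by (simp add: S)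
    finally have "R m < \<infinity>"
      using a[of m] by (auto simp: ennreal_mult_less_top less_top)
    then show ?thesis by simp
  qed
  then show "R m = ennreal (enn2real (R m))" .
  have "(\<lambda>m. ennreal (a m) * R m) sums ennreal S"
    unfolding S(1)[symmetric] by (rule summable_sums) simp
  also have "(\<lambda>m. ennreal (a m) * R m) = (\<lambda>m. ennreal (a m * enn2real (R m)))"
    by (intro ext) (metis R a ennreal_mult enn2real_nonneg less_imp_le)
  finally show "(\<lambda>m. a m * enn2real (R m)) sums S"
    using a S(2) by (subst (asm) sums_ennreal) (auto simp: less_imp_le)
qed

text \<open>All terms are non-negative, so sum and integral can be exchanged before any moment is
  known to be finite.\<close>

lemma nn_integral_power_series:
  assumes [measurable]: "f \<in> borel_measurable M" "w \<in> borel_measurable M"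
    and a: "\<And>m. 0 \<le> a m" and f: "\<And>x. 0 \<le> f x" and w: "\<And>x. 0 \<le> w x"
    and F: "\<And>x. (\<lambda>m. a m * f x ^ m) sums F x"
  shows "(\<Sum>m. ennreal (a m) * (\<integral>\<^sup>+x. ennreal (f x ^ m * w x) \<partial>M)) = (\<integral>\<^sup>+x. ennreal (F x * w x) \<partial>M)"
proof -
  have "(\<Sum>m. ennreal (a m) * (\<integral>\<^sup>+x. ennreal (f x ^ m * w x) \<partial>M)) =
      (\<Sum>m. \<integral>\<^sup>+x. ennreal (a m * f x ^ m * w x) \<partial>M)"
    by (subst nn_integral_cmult[symmetric]) (auto simp: a f w ennreal_mult mult.assoc)
  also have "\<dots> = (\<integral>\<^sup>+x. (\<Sum>m. ennreal (a m * f x ^ m * w x)) \<partial>M)"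
    by (rule nn_integral_suminf[symmetric]) simp
  also have "\<dots> = (\<integral>\<^sup>+x. ennreal (F x * w x) \<partial>M)"
    by (intro nn_integral_cong suminf_ennreal_eq sums_mult2 F) (simp add: a f w)
  finally show ?thesis .
qed

text \<open>Weighting with \<open>exp (t * norm y ^ 2)\<close> amounts to dilating the Gaussian by
  \<open>sqrt (1 - t)\<close>, so the exponential generating function of the moments is a multiple
  of \<open>(1 - t) powr (- n / 2)\<close>. Its binomial coefficients are Pochhammer symbols over
  factorials.\<close>

lemma gauss_radial_moment:
  "(\<integral>\<^sup>+y. ennreal ((norm (y::'a::euclidean_space) ^ 2) ^ m * gauss y) \<partial>lborel) =
     ennreal (gauss_mass TYPE('a) * pochhammer (real DIM('a) / 2) m)" 
proof -
  let ?R = "\<lambda>m. \<integral>\<^sup>+y. ennreal ((norm (y::'a) ^ 2) ^ m * gauss y) \<partial>lborel"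
  let ?Z = "gauss_mass TYPE('a)" and ?n = "real DIM('a)"
  have int: "(\<integral>\<^sup>+y. ennreal (exp (t * norm y ^ 2) * gauss (y::'a)) \<partial>lborel) = ennreal (?Z * (1 - t) powr (- ?n / 2))"
    if t: "0 < t" "t < 1" for t
  proof -
    define s where "s = sqrt (1 - t)"
    have s: "0 < s" "s\<^sup>2 = 1 - t" using t by (auto simp: s_def)
    have "exp (t * norm y ^ 2) * gauss (y::'a) = gauss (s *\<^sub>R y)" for y
      by (simp add: gauss_def power_mult_distrib s(2) algebra_simps flip: exp_add)
    then have "ennreal (s ^ DIM('a)) * (\<integral>\<^sup>+y. ennreal (exp (t * norm y ^ 2) * gauss (y::'a)) \<partial>lborel) = ennreal ?Z"
      using nn_integral_lborel_scale[of "\<lambda>x::'a. ennreal (gauss x)" s] s by (simp add: nn_integral_gauss)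
    then have "ennreal (1 / s ^ DIM('a)) * ennreal (s ^ DIM('a)) *
        (\<integral>\<^sup>+y. ennreal (exp (t * norm y ^ 2) * gauss (y::'a)) \<partial>lborel) = ennreal (1 / s ^ DIM('a)) * ennreal ?Z"
      by (simp add: mult.assoc)
    moreover have "ennreal (1 / s ^ DIM('a)) * ennreal (s ^ DIM('a)) = 1"
      using s by (simp flip: ennreal_mult)
    moreover have "1 / s ^ DIM('a) = (1 - t) powr (- ?n / 2)"
      using s t by (simp add: s_def powr_half_sqrt[symmetric] powr_minus_divide powr_powr flip: powr_realpow)
    ultimately show ?thesis
      using gauss_mass_pos[where 'a='a] by (simp add: ennreal_mult[symmetric] mult.commute)
  qed
  have *: "?R m = ennreal (enn2real (?R m))"
    "(\<lambda>m. (t ^ m / fact m) * enn2real (?R m)) sums (?Z * (1 - t) powr (- ?n / 2))"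
    if t: "0 < t" "t < 1" for t m
  proof -
    have "(\<lambda>m. (t ^ m / fact m) * (norm y ^ 2) ^ m) sums exp (t * norm (y::'a) ^ 2)" for y
      using exp_converges[of "t * norm (y::'a) ^ 2"] by (simp add: power_mult_distrib field_simps)
    then have "(\<Sum>m. ennreal (t ^ m / fact m) * ?R m) = (\<integral>\<^sup>+y. ennreal (exp (t * norm y ^ 2) * gauss (y::'a)) \<partial>lborel)"
      using t by (intro nn_integral_power_series) (auto simp: gauss_pos less_imp_le)
    note ennreal_sums_of_suminf[of "\<lambda>m. t ^ m / fact m" ?R, OF _ this[unfolded int[OF t]]]
    then show "?R m = ennreal (enn2real (?R m))"
      "(\<lambda>m. (t ^ m / fact m) * enn2real (?R m)) sums (?Z * (1 - t) powr (- ?n / 2))"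
      using t gauss_mass_pos[where 'a='a] by auto
  qed
  have "(\<lambda>m. enn2real (?R m) / fact m) = (\<lambda>m. ?Z * pochhammer (?n / 2) m / fact m)"
  proof (rule powser_unique_right[where r = 1])
    fix t :: real assume t: "0 < t" "t < 1"
    show "(\<lambda>m. enn2real (?R m) / fact m * t ^ m) sums (?Z * (1 - t) powr (- ?n / 2))"
      using *(2)[OF t] by (simp add: field_simps)
    \<comment> \<open>The sign of the generalised binomial coefficient cancels against that of
      \<open>(- t) ^ m\<close>.\<close>
    have "(- 1) ^ m * ((- 1) ^ m * c) = (c::real)" for m c
      by (simp flip: mult.assoc power_mult_distrib)
    then have "?Z * ((- ?n / 2 gchoose m) * (- t) ^ m) = ?Z * pochhammer (?n / 2) m / fact m * t ^ m" for m
      by (simp add: gbinomial_pochhammer power_minus[of t] mult_ac)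
    moreover have "(\<lambda>m. (- ?n / 2 gchoose m) * (- t) ^ m) sums (1 + - t) powr (- ?n / 2)"
      using t by (intro gen_binomial_real) auto
    from sums_mult[OF this, of ?Z]
    have "(\<lambda>m. ?Z * ((- ?n / 2 gchoose m) * (- t) ^ m)) sums (?Z * (1 - t) powr (- ?n / 2))" by simp
    ultimately show "(\<lambda>m. ?Z * pochhammer (?n / 2) m / fact m * t ^ m) sums (?Z * (1 - t) powr (- ?n / 2))"
      by simp
  qed simp
  then have "enn2real (?R m) = ?Z * pochhammer (?n / 2) m"
    by (auto simp: fun_eq_iff)
  then show ?thesis
    using *(1)[of "1/2" m] by simp
qed

text \<open>Completing the square: translation by \<open>w\<close> turns the integrand into a
  constant times the Gaussian.\<close>

lemma nn_integral_exp_gauss: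
  "(\<integral>\<^sup>+y. ennreal (exp (2 * (w \<bullet> y)) * gauss y) \<partial>lborel) =
     ennreal (exp (norm w ^ 2) * gauss_mass TYPE('a))" for w :: "'a::euclidean_space"
proof -
  have "exp (2 * (w \<bullet> (w + y))) * gauss (w + y) = exp (norm w ^ 2) * gauss y" for y
    by (simp add: gauss_def power2_norm_eq_inner inner_simps inner_commute flip: exp_add)
  then have "(\<integral>\<^sup>+y. ennreal (exp (2 * (w \<bullet> y)) * gauss y) \<partial>distr lborel borel ((+) w)) =
      (\<integral>\<^sup>+y. ennreal (exp (norm w ^ 2) * gauss (y::'a)) \<partial>lborel)"
    by (simp add: nn_integral_distr)
  then show ?thesis
    by (simp add: lborel_distr_plus ennreal_mult' nn_integral_cmult nn_integral_gauss)
qed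

text \<open>Here the generating function is \<open>cosh\<close> instead of \<open>exp\<close>: it
  keeps only the even moments, all terms are non-negative, and with \<open>u = s\<^sup>2\<close> it
  is a power series in \<open>u\<close>. Averaging \<open>nn_integral_exp_gauss\<close> over both
  signs of \<open>s\<close> evaluates it.\<close>

lemma gauss_directional_moment:
  fixes x :: "'a::euclidean_space"
  shows "(\<integral>\<^sup>+y. ennreal (((x \<bullet> y) ^ 2) ^ m * gauss y) \<partial>lborel) =
     ennreal (gauss_mass TYPE('a) * (fact (2 * m) / (4 ^ m * fact m)) * (norm x ^ 2) ^ m)"
proof -
  let ?R = "\<lambda>m. \<integral>\<^sup>+y. ennreal (((x \<bullet> y) ^ 2) ^ m * gauss y) \<partial>lborel"
  let ?Z = "gauss_mass TYPE('a)"
  have Z: "0 < ?Z" by (rule gauss_mass_pos)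
  have int: "(\<integral>\<^sup>+y. ennreal (cosh (2 * s * (x \<bullet> y)) * gauss y) \<partial>lborel) =
      ennreal (?Z * exp (s\<^sup>2 * norm x ^ 2))" for s
  proof -
    have "ennreal (cosh (2 * s * (x \<bullet> y)) * gauss y) = ennreal (1/2) *
        (ennreal (exp (2 * ((s *\<^sub>R x) \<bullet> y)) * gauss y) + ennreal (exp (2 * ((- s *\<^sub>R x) \<bullet> y)) * gauss y))" for y
    proof -
      have "cosh (2 * s * (x \<bullet> y)) * gauss y = 1 / 2 *
          (exp (2 * ((s *\<^sub>R x) \<bullet> y)) * gauss y + exp (2 * ((- s *\<^sub>R x) \<bullet> y)) * gauss y)"
        by (simp add: cosh_def field_simps)
      then show ?thesis
        using gauss_pos[of y] by (simp only: ennreal_mult ennreal_plus mult_nonneg_nonneg exp_ge_zero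
            less_imp_le add_nonneg_nonneg zero_le_divide_1_iff zero_le_numeral)
    qed
    then have "(\<integral>\<^sup>+y. ennreal (cosh (2 * s * (x \<bullet> y)) * gauss y) \<partial>lborel) = ennreal (1/2) *
        ((\<integral>\<^sup>+y. ennreal (exp (2 * ((s *\<^sub>R x) \<bullet> y)) * gauss y) \<partial>lborel) +
         (\<integral>\<^sup>+y. ennreal (exp (2 * ((- s *\<^sub>R x) \<bullet> y)) * gauss y) \<partial>lborel))"
      by (simp add: nn_integral_cmult nn_integral_add)
    also have "\<dots> = ennreal (1/2) * (ennreal (exp (norm (s *\<^sub>R x) ^ 2) * ?Z) +
        ennreal (exp (norm (- s *\<^sub>R x) ^ 2) * ?Z))"
      by (simp only: nn_integral_exp_gauss)
    also have "\<dots> = ennreal (1/2 * (exp (norm (s *\<^sub>R x) ^ 2) * ?Z + exp (norm (- s *\<^sub>R x) ^ 2) * ?Z))"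
      using Z by (simp only: ennreal_mult ennreal_plus mult_nonneg_nonneg exp_ge_zero
            less_imp_le add_nonneg_nonneg zero_le_divide_1_iff zero_le_numeral)
    also have "1/2 * (exp (norm (s *\<^sub>R x) ^ 2) * ?Z + exp (norm (- s *\<^sub>R x) ^ 2) * ?Z) =
        ?Z * exp (s\<^sup>2 * norm x ^ 2)"
      by (simp add: power_mult_distrib)
    finally show ?thesis .
  qed
  have *: "?R m = ennreal (enn2real (?R m))"
    "(\<lambda>m. (4 ^ m * u ^ m / fact (2 * m)) * enn2real (?R m)) sums (?Z * exp (u * norm x ^ 2))"
    if u: "0 < u" for u m
  proof -
    define s where "s = sqrt u"
    have s: "s\<^sup>2 = u" using u by (simp add: s_def)
    have "(\<lambda>m. (4 ^ m * u ^ m / fact (2 * m)) * ((x \<bullet> y) ^ 2) ^ m) sums cosh (2 * s * (x \<bullet> y))" for y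
    proof -
      \<comment> \<open>The odd terms of the series are zero, so it may be reindexed along the even
        numbers.\<close>
      have "(\<lambda>m. (\<lambda>n. if even n then (2 * s * (x \<bullet> y)) ^ n /\<^sub>R fact n else 0) (2 * m)) sums cosh (2 * s * (x \<bullet> y))"
        using cosh_converges[of "2 * s * (x \<bullet> y)"]
        by (subst sums_mono_reindex) (auto simp: strict_mono_def elim!: oddE evenE)
      moreover have "(2 * s * (x \<bullet> y)) ^ (2 * m) = 4 ^ m * u ^ m * ((x \<bullet> y) ^ 2) ^ m" for m
        unfolding power_mult by (simp add: power_mult_distrib s)
      ultimately show ?thesis by (simp add: field_simps)
    qed
    then have "(\<Sum>m. ennreal (4 ^ m * u ^ m / fact (2 * m)) * ?R m) =
        (\<integral>\<^sup>+y. ennreal (cosh (2 * s * (x \<bullet> y)) * gauss y) \<partial>lborel)"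
      using u by (intro nn_integral_power_series) (auto simp: gauss_pos less_imp_le)
    note ennreal_sums_of_suminf[of "\<lambda>m. 4 ^ m * u ^ m / fact (2 * m)" ?R, OF _ this[unfolded int s]]
    then show "?R m = ennreal (enn2real (?R m))"
      "(\<lambda>m. (4 ^ m * u ^ m / fact (2 * m)) * enn2real (?R m)) sums (?Z * exp (u * norm x ^ 2))"
      using u Z by auto
  qed
  have "(\<lambda>m. 4 ^ m / fact (2 * m) * enn2real (?R m)) = (\<lambda>m. ?Z * (norm x ^ 2) ^ m / fact m)"
  proof (rule powser_unique_right[where r = 1])
    fix u :: real assume u: "0 < u"
    show "(\<lambda>m. 4 ^ m / fact (2 * m) * enn2real (?R m) * u ^ m) sums (?Z * exp (u * norm x ^ 2))"
      using *(2)[OF u] by (simp add: field_simps)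
    show "(\<lambda>m. ?Z * (norm x ^ 2) ^ m / fact m * u ^ m) sums (?Z * exp (u * norm x ^ 2))"
      using sums_mult[OF exp_converges[of "u * norm x ^ 2"], of ?Z]
      by (simp add: power_mult_distrib field_simps)
  qed simp
  then have "4 ^ m / fact (2 * m) * enn2real (?R m) = ?Z * (norm x ^ 2) ^ m / fact m"
    by (rule fun_cong)
  then have "enn2real (?R m) = ?Z * (fact (2 * m) / (4 ^ m * fact m)) * (norm x ^ 2) ^ m"
    by (simp add: field_simps)
  then show ?thesis
    using *(1)[of 1 m] by simp
qed

section \<open>Moments of the surface measure and the Bessel series\<close>

text \<open>Polar coordinates with radial factor \<open>norm y ^ (2 * m)\<close> times the Gaussian
  turn the angular integrand into \<open>(x \<bullet> y) ^ (2 * m)\<close>. The moment is thus the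
  total mass of the sphere times the quotient of the two Gaussian moments.\<close>

lemma sphere_moment:
  fixes x :: "'a::euclidean_space"
  shows "(\<integral>\<^sup>+w. ennreal ((x \<bullet> w) ^ (2 * m)) \<partial>sphere_measure) =
    ennreal (measure sphere_measure (sphere (0::'a) 1) *
      (fact (2 * m) * (norm x / 2) ^ (2 * m) / (fact m * pochhammer (real DIM('a) / 2) m)))"
proof -
  let ?S = "measure sphere_measure (sphere (0::'a) 1)" and ?P = "pochhammer (real DIM('a) / 2) m"
  let ?I = "\<integral>\<^sup>+w. ennreal ((x \<bullet> w) ^ (2 * m)) \<partial>sphere_measure"
  let ?Z = "gauss_mass TYPE('a)"
  interpret finite_measure "sphere_measure :: 'a measure"
    by (rule finite_measure_sphere_measure)
  have P: "0 < ?P" by (intro pochhammer_pos) simp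
  \<comment> \<open>Finiteness is established first because it is a premise of
    \<open>nn_integral_polar\<close>.\<close>
  have "?I \<le> (\<integral>\<^sup>+w. ennreal (norm x ^ (2 * m)) \<partial>(sphere_measure :: 'a measure))"
  proof (intro nn_integral_mono ennreal_leI)
    fix w :: 'a assume "w \<in> space sphere_measure"
    then have "\<bar>x \<bullet> w\<bar> \<le> norm x"
      using Cauchy_Schwarz_ineq2[of x w] by (simp add: space_sphere_measure)
    then have "\<bar>x \<bullet> w\<bar> ^ (2 * m) \<le> norm x ^ (2 * m)" by (intro power_mono) auto
    then show "(x \<bullet> w) ^ (2 * m) \<le> norm x ^ (2 * m)" by (simp add: power_even_abs)
  qed
  also have "\<dots> < \<infinity>" by (simp add: ennreal_mult_less_top emeasure_eq_measure)
  finally have fin: "?I < \<infinity>" .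
  then obtain i where i: "?I = ennreal i" "0 \<le> i"
    by (cases ?I) auto
  have "emeasure sphere_measure (sphere (0::'a) 1) *
      (\<integral>\<^sup>+y. ennreal ((norm y ^ 2) ^ m * gauss y) * ennreal ((x \<bullet> (y /\<^sub>R norm y)) ^ (2 * m)) \<partial>lborel) =
      ?I * (\<integral>\<^sup>+y. ennreal ((norm (y::'a) ^ 2) ^ m * gauss y) \<partial>lborel)"
    using nn_integral_polar[of "\<lambda>w. ennreal ((x \<bullet> w) ^ (2 * m))" "\<lambda>r. ennreal ((r ^ 2) ^ m * exp (- (r ^ 2)))"] fin
    by (simp add: gauss_def)
  also have "(\<lambda>y. ennreal ((norm y ^ 2) ^ m * gauss y) * ennreal ((x \<bullet> (y /\<^sub>R norm y)) ^ (2 * m))) =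
      (\<lambda>y. ennreal (((x \<bullet> y) ^ 2) ^ m * gauss y))"
  proof
    fix y :: 'a
    have "(norm y ^ 2) ^ m * gauss y * (x \<bullet> (y /\<^sub>R norm y)) ^ (2 * m) =
        ((norm y * (x \<bullet> (y /\<^sub>R norm y))) ^ 2) ^ m * gauss y"
      by (simp add: power_mult power_mult_distrib)
    also have "norm y * (x \<bullet> (y /\<^sub>R norm y)) = x \<bullet> y"
      by (cases "y = 0") auto
    finally show "ennreal ((norm y ^ 2) ^ m * gauss y) * ennreal ((x \<bullet> (y /\<^sub>R norm y)) ^ (2 * m)) =
        ennreal (((x \<bullet> y) ^ 2) ^ m * gauss y)"
      using gauss_pos[of y] by (simp add: less_imp_le flip: ennreal_mult)
  qed
  finally have "ennreal (?S * (?Z * (fact (2 * m) / (4 ^ m * fact m)) * (norm x ^ 2) ^ m)) = ennreal (i * (?Z * ?P))"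
    unfolding gauss_directional_moment gauss_radial_moment emeasure_eq_measure i(1)
    using P gauss_mass_pos[where 'a='a] i(2)
    by (subst (1 2) ennreal_mult) auto
  then have "?S * (?Z * (fact (2 * m) / (4 ^ m * fact m)) * (norm x ^ 2) ^ m) = i * (?Z * ?P)"
    using P gauss_mass_pos[where 'a='a] i by (subst (asm) ennreal_inj) auto
  then have "?S * ((fact (2 * m) / (4 ^ m * fact m)) * (norm x ^ 2) ^ m) = i * ?P"
  proof -
    assume "?S * (?Z * (fact (2 * m) / (4 ^ m * fact m)) * (norm x ^ 2) ^ m) = i * (?Z * ?P)"
    then have "?Z * (?S * ((fact (2 * m) / (4 ^ m * fact m)) * (norm x ^ 2) ^ m)) = ?Z * (i * ?P)"
      by (simp only: mult_ac)
    then show ?thesis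
      using gauss_mass_pos[where 'a='a] by (subst (asm) mult_left_cancel) auto
  qed
  then have "i = ?S * (fact (2 * m) * (norm x / 2) ^ (2 * m) / (fact m * ?P))"
  proof -
    assume eq: "?S * ((fact (2 * m) / (4 ^ m * fact m)) * (norm x ^ 2) ^ m) = i * ?P"
    have half: "(norm x / 2) ^ (2 * m) = (norm x ^ 2) ^ m / 4 ^ m"
      unfolding power_mult by (simp add: power_divide)
    show ?thesis
      unfolding half using eq P by (simp add: field_simps)
  qed
  then show ?thesis using i by simp
qed

text \<open>The functional equation of \<open>Gamma\<close> gives
  \<open>Gamma (m + a + 1) = pochhammer (a + 1) m * Gamma (a + 1)\<close>, and the normalising
  factors of \<open>bessel_j\<close> cancel the rest. At \<open>t = 0\<close> only the term
  \<open>m = 0\<close> survives, in agreement with the convention there.\<close>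

lemma bessel_j_sums:
  assumes S: "(\<lambda>m. (-1) ^ m * (t / 2) ^ (2 * m) / (fact m * pochhammer (a + 1) m)) sums S"
    and a: "0 \<le> a" and t: "0 \<le> t"
  shows "bessel_j a t = S"
proof (cases "t = 0")
  case True
  have "(\<lambda>m. (-1) ^ m * (t / 2) ^ (2 * m) / (fact m * pochhammer (a + 1) m)) =
      (\<lambda>m. if m = 0 then 1 else 0)"
    using True by (auto simp: fun_eq_iff)
  with S have "S = 1" using sums_single[of 0 "\<lambda>_. 1::real"] by (auto intro: sums_unique2)
  then show ?thesis using True by (simp add: bessel_j_def)
next
  case False
  with t have t: "0 < t" by simp
  have G: "Gamma (a + 1) > 0" using a by (intro Gamma_real_pos) simp
  define y where "y = t / 2"
  have y: "0 < y" using t by (simp add: y_def)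
  have "(-1) ^ m * rGamma (real m + a + 1) / fact m * y powr (2 * real m + a) =
      y powr a / Gamma (a + 1) * ((-1) ^ m * y ^ (2 * m) / (fact m * pochhammer (a + 1) m))" for m
  proof -
    have "a + 1 \<notin> \<int>\<^sub>\<le>\<^sub>0" using a by (auto elim!: nonpos_Ints_cases)
    then have poch: "pochhammer (a + 1) m = Gamma (real m + a + 1) / Gamma (a + 1)"
      by (simp add: pochhammer_Gamma add_ac)
    have Gm: "Gamma (real m + a + 1) > 0" using a by (intro Gamma_real_pos) simp
    have "y powr (2 * real m + a) = y powr a * y powr real (2 * m)"
      by (simp add: powr_add)
    also have "y powr real (2 * m) = y ^ (2 * m)"
      using y by (rule powr_realpow)
    finally have powr: "y powr (2 * real m + a) = y powr a * y ^ (2 * m)" .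
    show ?thesis
      unfolding poch powr rGamma_inverse_Gamma using G Gm by (simp add: divide_inverse mult_ac)
  qed
  note eq = this[unfolded y_def]
  have "(\<lambda>m. (-1) ^ m * rGamma (real m + a + 1) / fact m * (t / 2) powr (2 * real m + a)) sums
      ((t / 2) powr a / Gamma (a + 1) * S)"
    unfolding eq by (rule sums_mult[OF S])
  then have "bessel_J a t = (t / 2) powr a / Gamma (a + 1) * S"
    unfolding bessel_J_def by (rule sums_unique[symmetric])
  then show ?thesis
    using t G by (simp add: bessel_j_def powr_minus field_simps)
qed

text \<open>The cosine series is integrated term by term, dominated by the series of
  \<open>cosh (norm x)\<close>. The factor \<open>fact (2 * m)\<close> in the moments cancels the
  denominators of the cosine. The dimension bound makes the Bessel order non-negative.\<close>

lemma integral_cos_sphere_measure: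
  fixes x :: "'a::euclidean_space"
  assumes "2 \<le> DIM('a)"
  shows "(LINT w|sphere_measure. cos (x \<bullet> w)) =
    measure sphere_measure (sphere (0::'a) 1) * bessel_j (real DIM('a) / 2 - 1) (norm x)"
proof -
  let ?S = "measure sphere_measure (sphere (0::'a) 1)" and ?P = "pochhammer (real DIM('a) / 2)"
  let ?M = "sphere_measure :: 'a measure"
  interpret finite_measure ?M by (rule finite_measure_sphere_measure)
  have S: "0 < ?S" by (simp add: measure_def emeasure_sphere_measure_UNIV)
  define f where "f = (\<lambda>m (w::'a). (-1) ^ m / fact (2 * m) * (x \<bullet> w) ^ (2 * m))"
  have bound: "norm (f m w) \<le> norm x ^ (2 * m) / fact (2 * m)" if "w \<in> space ?M" for m w
  proof -
    have "\<bar>x \<bullet> w\<bar> \<le> norm x"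
      using that Cauchy_Schwarz_ineq2[of x w] by (simp add: space_sphere_measure)
    then have "\<bar>x \<bullet> w\<bar> ^ (2 * m) \<le> norm x ^ (2 * m)" by (intro power_mono) auto
    then show ?thesis
      by (simp add: f_def abs_mult power_abs divide_right_mono)
  qed
  have [measurable]: "f m \<in> borel_measurable ?M" for m
    unfolding f_def by (intro measurable_sphere_measure) simp
  have int: "integrable ?M (f m)" for m
    by (rule integrable_const_bound[OF AE_I2[OF bound]]) auto
  have "summable (\<lambda>m. norm x ^ (2 * m) / fact (2 * m))"
  proof -
    have "(\<lambda>m. (\<lambda>n. if even n then norm x ^ n /\<^sub>R fact n else 0) (2 * m)) sums cosh (norm x)"
      using cosh_converges[of "norm x"]
      by (subst sums_mono_reindex) (auto simp: strict_mono_def elim!: oddE evenE)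
    then show ?thesis by (auto dest!: sums_summable simp: field_simps)
  qed
  note sm = this
  have "(\<lambda>m. integral\<^sup>L ?M (f m)) sums (LINT w|?M. (\<Sum>m. f m w))"
  proof (rule sums_integral[OF int])
    show "AE w in ?M. summable (\<lambda>m. norm (f m w))"
      by (intro AE_I2 summable_comparison_test'[OF sm, of 0]) (use bound in simp)
    show "summable (\<lambda>m. LINT w|?M. norm (f m w))"
    proof (rule summable_comparison_test'[where N = 0])
      show "summable (\<lambda>m. norm x ^ (2 * m) / fact (2 * m) * ?S)"
        by (rule summable_mult2[OF sm])
      fix m
      have "(LINT w|?M. norm (f m w)) \<le> (LINT w|?M. norm x ^ (2 * m) / fact (2 * m))"
        by (intro integral_mono integrable_norm int bound) auto
      then show "norm (LINT w|?M. norm (f m w)) \<le> norm x ^ (2 * m) / fact (2 * m) * ?S"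
        by (simp add: space_sphere_measure mult.commute)
    qed
  qed
  also have "(\<lambda>w. \<Sum>m. f m w) = (\<lambda>w. cos (x \<bullet> w))"
    unfolding f_def using cos_paired by (auto simp: sums_iff)
  also have "(\<lambda>m. integral\<^sup>L ?M (f m)) =
      (\<lambda>m. ?S * ((-1) ^ m * (norm x / 2) ^ (2 * m) / (fact m * ?P m)))"
  proof
    fix m
    have P: "0 < ?P m" by (intro pochhammer_pos) simp
    have "(LINT w|?M. (x \<bullet> w) ^ (2 * m)) = ?S * (fact (2 * m) * (norm x / 2) ^ (2 * m) / (fact m * ?P m))"
      using P S by (subst integral_eq_nn_integral)
        (auto simp: sphere_moment intro!: measurable_sphere_measure mult_nonneg_nonneg divide_nonneg_pos)
    then show "integral\<^sup>L ?M (f m) = ?S * ((-1) ^ m * (norm x / 2) ^ (2 * m) / (fact m * ?P m))"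
      by (simp add: f_def)
  qed
  finally have "(\<lambda>m. ?S * ((-1) ^ m * (norm x / 2) ^ (2 * m) / (fact m * ?P m))) sums
      (LINT w|?M. cos (x \<bullet> w))" .
  from sums_divide[OF this, of ?S]
  have "(\<lambda>m. (-1) ^ m * (norm x / 2) ^ (2 * m) / (fact m * ?P m)) sums
      ((LINT w|?M. cos (x \<bullet> w)) / ?S)"
    using S by simp
  then have "bessel_j (real DIM('a) / 2 - 1) (norm x) = (LINT w|?M. cos (x \<bullet> w)) / ?S"
    using assms by (intro bessel_j_sums) auto
  then show ?thesis using S by simp
qed

section \<open>The restriction inequality as a dual bound\<close>

definition sphere_bessel :: "'a::euclidean_space \<Rightarrow> real" where
  "sphere_bessel x = bessel_j (real DIM('a) / 2 - 1) (norm x)"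

lemma sphere_measure_pos:
  "0 < measure sphere_measure (sphere (0::'a::euclidean_space) 1)"
  by (simp add: measure_def emeasure_sphere_measure_UNIV)

text \<open>As a mean of cosines, the Bessel factor is visibly measurable and bounded by 1, and
  integration against it is accessible to Fubini.\<close>

lemma sphere_bessel_eq:
  assumes "2 \<le> DIM('a::euclidean_space)"
  shows "sphere_bessel (x::'a) =
    (LINT w|sphere_measure. cos (x \<bullet> w)) / measure sphere_measure (sphere (0::'a) 1)"
  using integral_cos_sphere_measure[OF assms, of x] sphere_measure_pos[where 'a='a]
  by (simp add: sphere_bessel_def)

lemma measurable_id_sphere_measure:
  "(\<lambda>w. w) \<in> (sphere_measure :: 'a::euclidean_space measure) \<rightarrow>\<^sub>M borel"
  by (rule measurable_sphere_measure) simp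

lemma borel_measurable_sphere_bessel:
  assumes "2 \<le> DIM('a::euclidean_space)"
  shows "(sphere_bessel :: 'a \<Rightarrow> real) \<in> borel_measurable borel"
proof -
  interpret finite_measure "sphere_measure :: 'a measure"
    by (rule finite_measure_sphere_measure)
  have [measurable]: "snd \<in> borel \<Otimes>\<^sub>M (sphere_measure :: 'a measure) \<rightarrow>\<^sub>M borel"
    using measurable_compose[OF measurable_snd measurable_id_sphere_measure] .
  have "(\<lambda>x::'a. LINT w|sphere_measure. cos (x \<bullet> w)) \<in> borel_measurable borel"
    by (rule borel_measurable_lebesgue_integral) (unfold case_prod_beta, measurable)
  then show ?thesis
    unfolding sphere_bessel_eq[OF assms, abs_def] by simp
qed

lemma abs_sphere_bessel_le_1:
  assumes "2 \<le> DIM('a::euclidean_space)"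
  shows "\<bar>sphere_bessel (x::'a)\<bar> \<le> 1"
proof -
  interpret finite_measure "sphere_measure :: 'a measure"
    by (rule finite_measure_sphere_measure)
  let ?M = "sphere_measure :: 'a measure"
  have int: "integrable ?M (\<lambda>w. cos (x \<bullet> w))"
    by (rule integrable_const_bound[where B = 1]) (auto intro!: measurable_sphere_measure)
  have "\<bar>LINT w|?M. cos (x \<bullet> w)\<bar> \<le> (LINT w|?M. \<bar>cos (x \<bullet> w)\<bar>)"
    by (rule integral_abs_bound)
  also have "\<dots> \<le> (LINT w|?M. 1)"
    by (intro integral_mono integrable_abs int integrable_const) auto
  finally have "\<bar>LINT w|?M. cos (x \<bullet> w)\<bar> \<le> (LINT w|?M. 1)" .
  then show ?thesis
    using sphere_measure_pos[where 'a='a]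
    by (simp add: sphere_bessel_eq[OF assms] abs_divide space_sphere_measure)
qed

text \<open>Fubini on the finite sphere measure times Lebesgue measure, where the integrand is
  dominated by \<open>\<bar>f x\<bar>\<close>.\<close>

lemma integral_sphere_bessel:
  fixes f :: "'a::euclidean_space \<Rightarrow> real"
  assumes dim: "2 \<le> DIM('a)" and f: "integrable lborel f"
  shows "integrable sphere_measure (\<lambda>w. LINT x|lborel. cos (x \<bullet> w) * f x)"
    and "(LINT w|sphere_measure. LINT x|lborel. cos (x \<bullet> w) * f x) =
      measure sphere_measure (sphere (0::'a) 1) * (LINT x|lborel. f x * sphere_bessel x)"
proof -
  let ?M = "sphere_measure :: 'a measure"
  interpret M: finite_measure ?M by (rule finite_measure_sphere_measure)
  interpret pair_sigma_finite ?M "lborel :: 'a measure" ..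
  have [measurable]: "f \<in> borel_measurable borel"
    using borel_measurable_integrable[OF f] by simp
  have [measurable]: "fst \<in> ?M \<Otimes>\<^sub>M lborel \<rightarrow>\<^sub>M borel"
    using measurable_compose[OF measurable_fst measurable_id_sphere_measure] .
  have meas [measurable]: "(\<lambda>(w, x). cos (x \<bullet> w) * f x) \<in> borel_measurable (?M \<Otimes>\<^sub>M lborel)"
    unfolding case_prod_beta by measurable
  have int: "integrable lborel (\<lambda>x. cos (x \<bullet> w) * f x)" for w
    by (rule Bochner_Integration.integrable_bound[OF f]) (auto simp: abs_mult intro!: mult_left_le_one_le)
  have prod: "integrable (?M \<Otimes>\<^sub>M lborel) (\<lambda>(w, x). cos (x \<bullet> w) * f x)"
  proof (rule Fubini_integrable)
    show "integrable ?M (\<lambda>w. LINT x|lborel. norm (case (w, x) of (w, x) \<Rightarrow> cos (x \<bullet> w) * f x))"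
    proof (rule M.integrable_const_bound[where B = "LINT x|lborel. \<bar>f x\<bar>"], rule AE_I2)
      fix w
      have "(LINT x|lborel. \<bar>cos (x \<bullet> w) * f x\<bar>) \<le> (LINT x|lborel. \<bar>f x\<bar>)"
        by (intro integral_mono integrable_abs int f) (auto simp: abs_mult intro!: mult_left_le_one_le)
      then show "norm (LINT x|lborel. norm (case (w, x) of (w, x) \<Rightarrow> cos (x \<bullet> w) * f x)) \<le> (LINT x|lborel. \<bar>f x\<bar>)"
        by simp
    qed (use meas in measurable)
  qed (use int meas in auto)
  show "integrable ?M (\<lambda>w. LINT x|lborel. cos (x \<bullet> w) * f x)"
    using integrable_fst'[OF prod] by simp
  have "(LINT w|?M. LINT x|lborel. cos (x \<bullet> w) * f x) = (LINT x|lborel. LINT w|?M. cos (x \<bullet> w) * f x)"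
    by (rule Fubini_integral[OF prod, symmetric])
  also have "\<dots> = (LINT x|lborel. measure ?M (sphere 0 1) * (f x * sphere_bessel x))"
    using sphere_measure_pos[where 'a='a] by (simp add: sphere_bessel_eq[OF dim] mult.commute)
  finally show "(LINT w|?M. LINT x|lborel. cos (x \<bullet> w) * f x) =
      measure ?M (sphere 0 1) * (LINT x|lborel. f x * sphere_bessel x)"
    by simp
qed

text \<open>For real \<open>f\<close> the cosine transform is the real part of
  \<open>fourier\<close>, and it is all that the real kernel of \<open>sphere_bessel\<close>
  sees.\<close>

lemma
  fixes f :: "'a::euclidean_space \<Rightarrow> real"
  assumes f: "integrable lborel f"
  shows abs_integral_cos_le_fourier:
      "\<bar>LINT x|lborel. cos (x \<bullet> w) * f x\<bar> \<le> norm (fourier (\<lambda>x. complex_of_real (f x)) w)"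
    and measurable_fourier:
      "fourier (\<lambda>x. complex_of_real (f x)) \<in> borel_measurable borel"
proof -
  let ?F = "\<lambda>w x. exp (\<i> * complex_of_real (x \<bullet> w)) * complex_of_real (f x)"
  have [measurable]: "f \<in> borel_measurable borel"
    using borel_measurable_integrable[OF f] by simp
  have fourier: "fourier (\<lambda>x. complex_of_real (f x)) = (\<lambda>w. LINT x|lborel. ?F w x)"
    unfolding fourier_def by (intro ext integral_completion) measurable
  show "fourier (\<lambda>x. complex_of_real (f x)) \<in> borel_measurable borel"
    unfolding fourier by measurable
  have "integrable lborel (?F w)"
    by (rule Bochner_Integration.integrable_bound[OF f]) (auto simp: norm_mult)
  then have "(LINT x|lborel. Re (?F w x)) = Re (LINT x|lborel. ?F w x)"
    by (rule integral_Re)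
  also have "(\<lambda>x. Re (?F w x)) = (\<lambda>x. cos (x \<bullet> w) * f x)"
    by (simp add: Re_exp)
  finally show "\<bar>LINT x|lborel. cos (x \<bullet> w) * f x\<bar> \<le> norm (fourier (\<lambda>x. complex_of_real (f x)) w)"
    unfolding fourier using abs_Re_le_cmod by simp
qed

section \<open>From the restriction inequality to a bound on a linear functional\<close>

lemma measurable_epowr [measurable]:
  assumes [measurable]: "f \<in> borel_measurable M"
  shows "(\<lambda>x. f x epowr a) \<in> borel_measurable M"
proof (cases "a = 0")
  case False
  have [measurable]: "Measurable.pred borel (\<lambda>x::ennreal. x = c)" for c
    by (simp add: pred_def)
  have "(\<lambda>x. x epowr a) \<in> borel_measurable borel"
    unfolding epowr_def if_not_P[OF False]
    by (intro measurable_If borel_measurable_const) measurable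
  from measurable_compose[OF assms this] show ?thesis .
qed (simp add: epowr_def)

lemma epowr_le_1: "x \<le> 1 \<Longrightarrow> 0 < a \<Longrightarrow> x epowr a \<le> 1"
  by (cases x) (auto simp: epowr_def top_unique powr_le1)

text \<open>Removes the outer root in the restriction inequality; an infinite \<open>x\<close> is
  excluded since its root would be infinite too.\<close>

lemma epowr_inverse_le:
  assumes "x epowr (1 / q) \<le> ennreal c" "1 < q" "0 < c"
  shows "x \<le> ennreal (c powr q)"
proof (cases x)
  case (real r)
  show ?thesis
  proof (cases "r = 0")
    case False
    then have "r powr (1 / q) \<le> c"
      using assms real by (simp add: epowr_def)
    then have "(r powr (1 / q)) powr q \<le> c powr q"
      using assms by (intro powr_mono2) auto
    then show ?thesis
      using assms real by (simp add: powr_powr)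
  qed (use real in simp)
qed (use assms in \<open>simp add: epowr_def top_unique\<close>)

text \<open>Stands in for Hoelder's inequality on the sphere, the constants being irrelevant after
  normalising \<open>f\<close>; where \<open>u\<close> vanishes, the last term is infinite.\<close>

lemma ennreal_Young_weighted:
  assumes q: "1 < q" and a: "0 \<le> a" and u: "0 \<le> u"
  shows "ennreal a \<le> ennreal (a powr q * u) + ennreal u epowr (1 - conj_exponent q)"
proof (cases "u = 0")
  case True
  have "1 - conj_exponent q < 0"
    using q by (simp add: conj_exponent_def field_simps)
  then show ?thesis
    using True by (simp add: epowr_def)
next
  case False
  with u have u: "0 < u" by simp
  define q' where "q' = conj_exponent q"
  have q': "1 < q'" "1 / q + 1 / q' = 1" "1 - q' = - (q' / q)"
    using q by (auto simp: q'_def conj_exponent_def field_simps)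
  have nonneg: "0 \<le> a powr q * u" using u by simp
  have div_le: "c / r \<le> c" if "0 \<le> c" "1 < r" for c r :: real
    using that by (simp add: divide_le_eq mult_le_cancel_left1)
  \<comment> \<open>Young's inequality is applied after splitting off \<open>u powr (1 / q)\<close>;
    since \<open>q' / q = q' - 1\<close>, the other factor becomes
    \<open>u powr (1 - q')\<close>.\<close>
  have "a = (a * u powr (1 / q)) * u powr (- (1 / q))"
    using u by (simp add: powr_minus)
  also have "\<dots> \<le> (a * u powr (1 / q)) powr q / q + (u powr (- (1 / q))) powr q' / q'"
    using q q' a by (intro Youngs_inequality) auto
  also have "(a * u powr (1 / q)) powr q = a powr q * u"
    using q a u by (simp add: powr_mult powr_powr)
  also have "(u powr (- (1 / q))) powr q' = u powr (1 - q')"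
    by (simp add: powr_powr q'(3))
  also have "a powr q * u / q + u powr (1 - q') / q' \<le> a powr q * u + u powr (1 - q')"
    using q q' u nonneg by (intro add_mono div_le) auto
  finally have "ennreal a \<le> ennreal (a powr q * u) + ennreal (u powr (1 - q'))"
    using u by (simp flip: ennreal_plus)
  also have "ennreal (u powr (1 - q')) = ennreal u epowr (1 - conj_exponent q)"
    using u q' by (simp add: epowr_def q'_def)
  finally show ?thesis .
qed

lemma smooth_alg_integrable:
  assumes f: "smooth_alg f" and bd: "bounded {x. f x \<noteq> 0}"
  shows "integrable lborel f"
proof -
  have "compact (closure {x. f x \<noteq> 0})"
    using bd by (simp add: compact_closure)
  then have "integrable lborel (\<lambda>x. indicator (closure {x. f x \<noteq> 0}) x *\<^sub>R f x)"
    by (intro borel_integrable_compact continuous_on_smooth_alg f)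
  moreover have "(\<lambda>x. indicator (closure {x. f x \<noteq> 0}) x *\<^sub>R f x) = f"
  proof
    fix x show "indicator (closure {x. f x \<noteq> 0}) x *\<^sub>R f x = f x"
      using subsetD[OF closure_subset, of x "{x. f x \<noteq> 0}"] by (cases "f x = 0") auto
  qed
  ultimately show ?thesis by simp
qed

text \<open>The pointwise Young bound is not homogeneous in \<open>f\<close>, so the estimate is
  first proved for \<open>f\<close> of weighted norm at most 1 and then extended by scaling.\<close>

lemma restriction_duality:
  fixes p q C :: real and U v :: "'a::euclidean_space \<Rightarrow> real"
  assumes dim: "2 \<le> DIM('a)" and p: "1 < p" and q: "1 < q"
    and U [measurable]: "U \<in> borel_measurable sphere_measure"
    and U_nonneg: "\<And>w. w \<in> sphere 0 1 \<Longrightarrow> 0 \<le> U w"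
    and v [measurable]: "v \<in> borel_measurable lebesgue" and v_nonneg: "\<And>x. 0 \<le> v x"
    and C: "0 < C"
    and restr: "\<And>f. f \<in> test_functions \<Longrightarrow>
           (\<integral>\<^sup>+ w. ennreal (norm (fourier f w) powr q * U w) \<partial>sphere_measure) epowr (1 / q)
           \<le> ennreal C * (\<integral>\<^sup>+ x. ennreal (norm (f x) powr p * v x) \<partial>lebesgue) epowr (1 / p)"
    and fin: "(\<integral>\<^sup>+ w. ennreal (U w) epowr (1 - conj_exponent q) \<partial>sphere_measure) < \<infinity>"
  obtains D where "0 \<le> D"
    "\<And>f. smooth_alg f \<Longrightarrow> bounded {x. f x \<noteq> 0} \<Longrightarrow>
      integrable lebesgue (\<lambda>x. \<bar>f x\<bar> powr p * v x) \<Longrightarrow>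
      \<bar>LINT x|lebesgue. f x * sphere_bessel x\<bar> \<le> D * (LINT x|lebesgue. \<bar>f x\<bar> powr p * v x) powr (1 / p)"
proof -
  let ?M = "sphere_measure :: 'a measure"
  let ?S = "measure ?M (sphere 0 1)"
  interpret M: finite_measure ?M by (rule finite_measure_sphere_measure)
  note [measurable] = borel_measurable_sphere_bessel[OF dim]
  define W where "W = enn2real (\<integral>\<^sup>+ w. ennreal (U w) epowr (1 - conj_exponent q) \<partial>?M)"
  have W: "(\<integral>\<^sup>+ w. ennreal (U w) epowr (1 - conj_exponent q) \<partial>?M) = ennreal W" "0 \<le> W"
    using fin by (simp_all add: W_def)
  \<comment> \<open>\<open>C powr q\<close> and \<open>W\<close> bound the two integrals produced by
    Young's inequality; the mass of the sphere comes from
    \<open>integral_sphere_bessel\<close>.\<close>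
  define D where "D = (C powr q + W) / ?S"
  have S: "0 < ?S" by (rule sphere_measure_pos)
  have D: "0 \<le> D" using S W by (simp add: D_def)
  have norm1: "\<bar>LINT x|lebesgue. f x * sphere_bessel x\<bar> \<le> D"
    if f: "smooth_alg f" "bounded {x. f x \<noteq> 0}"
      and le1: "(\<integral>\<^sup>+x. ennreal (\<bar>f x\<bar> powr p * v x) \<partial>lebesgue) \<le> 1" for f
  proof -
    let ?F = "fourier (\<lambda>x. complex_of_real (f x))"
    have int: "integrable lborel f" by (rule smooth_alg_integrable[OF f])
    have [measurable]: "f \<in> borel_measurable borel"
      using borel_measurable_integrable[OF int] by simp
    have [measurable]: "?F \<in> borel_measurable ?M"
      by (intro measurable_sphere_measure measurable_fourier int)
    have "(\<integral>\<^sup>+ w. ennreal (norm (?F w) powr q * U w) \<partial>?M) epowr (1 / q) \<le>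
        ennreal C * (\<integral>\<^sup>+x. ennreal (\<bar>f x\<bar> powr p * v x) \<partial>lebesgue) epowr (1 / p)"
      using restr[OF smooth_alg_test_function[OF f]] by simp
    also have "\<dots> \<le> ennreal C * 1"
      using le1 p by (intro mult_left_mono epowr_le_1) auto
    finally have 1: "(\<integral>\<^sup>+ w. ennreal (norm (?F w) powr q * U w) \<partial>?M) \<le> ennreal (C powr q)"
      using q C by (intro epowr_inverse_le) auto
    have "(LINT x|lebesgue. f x * sphere_bessel x) = (LINT x|lborel. f x * sphere_bessel x)"
      by (rule integral_completion) simp
    then have "ennreal (?S * \<bar>LINT x|lebesgue. f x * sphere_bessel x\<bar>) =
        ennreal (norm (LINT w|?M. LINT x|lborel. cos (x \<bullet> w) * f x))"
      using S by (simp add: integral_sphere_bessel(2)[OF dim int] abs_mult)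
    also have "\<dots> \<le> (\<integral>\<^sup>+w. ennreal (norm (LINT x|lborel. cos (x \<bullet> w) * f x)) \<partial>?M)"
      by (intro integral_norm_bound_ennreal integral_sphere_bessel dim int)
    also have "\<dots> \<le> (\<integral>\<^sup>+w. ennreal (norm (?F w) powr q * U w) + ennreal (U w) epowr (1 - conj_exponent q) \<partial>?M)"
    proof (rule nn_integral_mono)
      fix w assume w: "w \<in> space ?M"
      have "ennreal (norm (LINT x|lborel. cos (x \<bullet> w) * f x)) \<le> ennreal (norm (?F w))"
        using abs_integral_cos_le_fourier[OF int] by (intro ennreal_leI) simp
      also have "\<dots> \<le> ennreal (norm (?F w) powr q * U w) + ennreal (U w) epowr (1 - conj_exponent q)"
        using w U_nonneg by (intro ennreal_Young_weighted q) (auto simp: space_sphere_measure)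
      finally show "ennreal (norm (LINT x|lborel. cos (x \<bullet> w) * f x)) \<le> \<dots>" .
    qed
    also have "\<dots> = (\<integral>\<^sup>+w. ennreal (norm (?F w) powr q * U w) \<partial>?M) + ennreal W"
      by (subst nn_integral_add) (auto simp: W)
    also have "\<dots> \<le> ennreal (C powr q) + ennreal W"
      using 1 by (rule add_right_mono)
    finally have "?S * \<bar>LINT x|lebesgue. f x * sphere_bessel x\<bar> \<le> C powr q + W"
      using W by (simp flip: ennreal_plus)
    then show ?thesis
      using S by (simp add: D_def field_simps)
  qed
  have "\<bar>LINT x|lebesgue. f x * sphere_bessel x\<bar> \<le> D * (LINT x|lebesgue. \<bar>f x\<bar> powr p * v x) powr (1 / p)"
    if f: "smooth_alg f" "bounded {x. f x \<noteq> 0}"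
      and int: "integrable lebesgue (\<lambda>x. \<bar>f x\<bar> powr p * v x)" for f
  proof -
    define I where "I = (LINT x|lebesgue. \<bar>f x\<bar> powr p * v x)"
    have I: "0 \<le> I" unfolding I_def by (simp add: v_nonneg)
    \<comment> \<open>An arbitrary \<open>s\<close> with \<open>I \<le> s powr p\<close> is allowed,
      rather than only the exact norm, so that \<open>I = 0\<close> is covered by letting
      \<open>s\<close> tend to 0.\<close>
    have scaled: "\<bar>LINT x|lebesgue. f x * sphere_bessel x\<bar> \<le> D * s" if s: "0 < s" "I \<le> s powr p" for s
    proof -
      have g: "smooth_alg (\<lambda>x. 1 / s * f x)"
        by (intro smooth_alg.mult smooth_alg.const f)
      have eq: "\<bar>1 / s * f x\<bar> powr p * v x = (1 / s) powr p * (\<bar>f x\<bar> powr p * v x)" for x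
        using s by (simp add: abs_mult powr_mult powr_divide)
      have "(\<integral>\<^sup>+x. ennreal (\<bar>1 / s * f x\<bar> powr p * v x) \<partial>lebesgue) = ennreal ((1 / s) powr p * I)"
        unfolding eq using int
        by (subst nn_integral_eq_integral) (auto simp: I_def v_nonneg)
      also have "\<dots> \<le> 1"
        using s by (simp add: powr_divide)
      finally have "\<bar>LINT x|lebesgue. 1 / s * f x * sphere_bessel x\<bar> \<le> D"
        using f s by (intro norm1 g) auto
      also have "(\<lambda>x. 1 / s * f x * sphere_bessel x) = (\<lambda>x. 1 / s * (f x * sphere_bessel x))"
        by simp
      finally show ?thesis
        using s by (simp add: abs_mult field_simps)
    qed
    show ?thesis
    proof (cases "I = 0")
      case True
      have "\<bar>LINT x|lebesgue. f x * sphere_bessel x\<bar> \<le> 0 + e" if "0 < e" for e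
      proof -
        have "D * (e / (D + 1)) \<le> e"
          using D that by (simp add: field_simps)
        moreover have "0 < e / (D + 1)" using D that by simp
        ultimately show ?thesis
          using scaled[of "e / (D + 1)"] True by force
      qed
      then have "\<bar>LINT x|lebesgue. f x * sphere_bessel x\<bar> \<le> 0"
        by (rule field_le_epsilon)
      then show ?thesis
        unfolding I_def[symmetric] using True by simp
    next
      case False
      then show ?thesis
        unfolding I_def[symmetric] using scaled[of "I powr (1 / p)"] I p by (simp add: powr_powr)
    qed
  qed
  with D show thesis by (rule that)
qed

section \<open>Extension to bounded measurable functions\<close>

lemma borel_measurable_lebesgue_continuous:
  fixes f :: "'a::euclidean_space \<Rightarrow> 'b::topological_space"
  shows "continuous_on UNIV f \<Longrightarrow> f \<in> borel_measurable lebesgue"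
  by (intro measurable_completion) (simp add: borel_measurable_continuous_onI)

text \<open>Fixes one cutoff with integrable \<open>\<phi> x powr p * v x\<close>. Products of
  \<open>\<phi>\<close> with bounded functions then have dominating functions on both sides of the
  dual bound.\<close>

locale cutoff_dual =
  fixes p D :: real and v J \<phi> :: "'a::euclidean_space \<Rightarrow> real" and K :: "'a set"
  assumes p: "1 < p" and D: "0 \<le> D"
    and v [measurable]: "v \<in> borel_measurable lebesgue" and v_nonneg: "\<And>x. 0 \<le> v x"
    and J [measurable]: "J \<in> borel_measurable lebesgue" and J_le: "\<And>x. \<bar>J x\<bar> \<le> 1"
    and cutoff: "smooth_alg \<phi>" "\<And>x. 0 \<le> \<phi> x"
    and K: "compact K" "\<And>x. \<phi> x \<noteq> 0 \<Longrightarrow> x \<in> K"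
    and weight: "integrable lebesgue (\<lambda>x. \<phi> x powr p * v x)"
    and dual: "\<And>f. smooth_alg f \<Longrightarrow> bounded {x. f x \<noteq> 0} \<Longrightarrow>
      integrable lebesgue (\<lambda>x. \<bar>f x\<bar> powr p * v x) \<Longrightarrow>
      \<bar>LINT x|lebesgue. f x * J x\<bar> \<le> D * (LINT x|lebesgue. \<bar>f x\<bar> powr p * v x) powr (1 / p)"
begin

text \<open>The dual bound for \<open>f * \<phi>\<close> rather than for \<open>f\<close>, so that
  \<open>f\<close> may be a polynomial and need have no compact support itself.\<close>

definition admissible :: "('a \<Rightarrow> real) \<Rightarrow> bool" where
  "admissible f \<longleftrightarrow> \<bar>LINT x|lebesgue. f x * \<phi> x * J x\<bar>
     \<le> D * (LINT x|lebesgue. \<bar>f x * \<phi> x\<bar> powr p * v x) powr (1 / p)"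

lemma bounded_supp: "bounded {x. \<phi> x \<noteq> 0}"
  by (rule bounded_subset[OF compact_imp_bounded[OF K(1)]]) (use K(2) in auto)

lemma cutoff_integrable: "integrable lebesgue \<phi>"
proof -
  have "integrable lborel \<phi>"
    by (rule smooth_alg_integrable[OF cutoff(1) bounded_supp])
  from this borel_measurable_integrable[OF this] show ?thesis
    by (simp add: integrable_completion)
qed

lemma cutoff_measurable [measurable]: "\<phi> \<in> borel_measurable lebesgue"
  using cutoff_integrable by auto

text \<open>Supplies the dominating functions. The bound on \<open>f\<close> is asked only where
  \<open>\<phi>\<close> is non-zero, since a polynomial is bounded there but not globally.\<close>

lemma weighted_le:
  assumes "\<And>x. \<phi> x \<noteq> 0 \<Longrightarrow> \<bar>f x\<bar> \<le> B" "0 \<le> B"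
  shows "\<bar>f x * \<phi> x * J x\<bar> \<le> B * \<phi> x"
    and "\<bar>f x * \<phi> x\<bar> powr p * v x \<le> B powr p * (\<phi> x powr p * v x)"
proof -
  have le: "\<bar>f x * \<phi> x\<bar> \<le> B * \<phi> x"
    using assms(1)[of x] cutoff(2)[of x] by (cases "\<phi> x = 0") (auto simp: abs_mult mult_right_mono)
  then show "\<bar>f x * \<phi> x * J x\<bar> \<le> B * \<phi> x"
    using mult_mono[OF le J_le[of x]] assms(2) cutoff(2)[of x] by (simp add: abs_mult)
  have "\<bar>f x * \<phi> x\<bar> powr p \<le> (B * \<phi> x) powr p"
    using le p by (intro powr_mono2) auto
  then show "\<bar>f x * \<phi> x\<bar> powr p * v x \<le> B powr p * (\<phi> x powr p * v x)"
    using assms(2) cutoff(2)[of x] v_nonneg[of x]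
    by (simp add: powr_mult mult.assoc[symmetric] mult_right_mono)
qed

lemma weighted_integrable:
  assumes [measurable]: "f \<in> borel_measurable lebesgue"
    and "\<And>x. \<phi> x \<noteq> 0 \<Longrightarrow> \<bar>f x\<bar> \<le> B" "0 \<le> B"
  shows "integrable lebesgue (\<lambda>x. f x * \<phi> x * J x)"
    and "integrable lebesgue (\<lambda>x. \<bar>f x * \<phi> x\<bar> powr p * v x)"
proof -
  show "integrable lebesgue (\<lambda>x. f x * \<phi> x * J x)"
    by (rule Bochner_Integration.integrable_bound[OF integrable_mult_right[OF cutoff_integrable, of B]])
      (use weighted_le(1)[of f B] assms cutoff(2) in \<open>auto simp: abs_mult\<close>)
  show "integrable lebesgue (\<lambda>x. \<bar>f x * \<phi> x\<bar> powr p * v x)"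
    by (rule Bochner_Integration.integrable_bound[OF integrable_mult_right[OF weight, of "B powr p"]])
      (use weighted_le(2)[of f B] assms v_nonneg in \<open>auto simp: abs_mult\<close>)
qed

text \<open>Dominated convergence applies to both integrals, so the inequality survives uniformly
  bounded limits almost everywhere on the support.\<close>

lemma admissible_limit:
  assumes meas [measurable]: "\<And>k. f k \<in> borel_measurable lebesgue" "g \<in> borel_measurable lebesgue"
    and B: "\<And>k x. \<phi> x \<noteq> 0 \<Longrightarrow> \<bar>f k x\<bar> \<le> B" "0 \<le> B"
    and lim: "AE x in lebesgue. \<phi> x \<noteq> 0 \<longrightarrow> (\<lambda>k. f k x) \<longlonglongrightarrow> g x"
    and adm: "\<And>k. admissible (f k)"
  shows "admissible g"
proof -
  have 1: "(\<lambda>k. LINT x|lebesgue. f k x * \<phi> x * J x) \<longlonglongrightarrow> (LINT x|lebesgue. g x * \<phi> x * J x)"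
  proof (rule integral_dominated_convergence[where w = "\<lambda>x. B * \<phi> x"])
    show "AE x in lebesgue. (\<lambda>k. f k x * \<phi> x * J x) \<longlonglongrightarrow> g x * \<phi> x * J x"
      using lim
    proof eventually_elim
      case (elim x)
      then show ?case by (cases "\<phi> x = 0") (auto intro!: tendsto_intros)
    qed
  qed (use weighted_le(1)[of "f _" B] B cutoff_integrable in auto)
  have 2: "(\<lambda>k. LINT x|lebesgue. \<bar>f k x * \<phi> x\<bar> powr p * v x) \<longlonglongrightarrow>
      (LINT x|lebesgue. \<bar>g x * \<phi> x\<bar> powr p * v x)"
  proof (rule integral_dominated_convergence[where w = "\<lambda>x. B powr p * (\<phi> x powr p * v x)"])
    show "AE x in lebesgue. (\<lambda>k. \<bar>f k x * \<phi> x\<bar> powr p * v x) \<longlonglongrightarrow> \<bar>g x * \<phi> x\<bar> powr p * v x"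
      using lim
    proof eventually_elim
      case (elim x)
      then show ?case
        using p by (cases "\<phi> x = 0") (auto intro!: tendsto_mult tendsto_powr' tendsto_rabs tendsto_const)
    qed
  qed (use weighted_le(2)[of "f _" B] B weight v_nonneg in auto)
  have 3: "(\<lambda>k. (LINT x|lebesgue. \<bar>f k x * \<phi> x\<bar> powr p * v x) powr (1 / p)) \<longlonglongrightarrow>
      (LINT x|lebesgue. \<bar>g x * \<phi> x\<bar> powr p * v x) powr (1 / p)"
    using p v_nonneg by (intro tendsto_powr'[OF 2 tendsto_const]) auto
  show ?thesis
    unfolding admissible_def
    by (rule LIMSEQ_le[OF tendsto_rabs[OF 1] tendsto_mult_left[OF 3]])
      (use adm in \<open>auto simp: admissible_def\<close>)
qed

text \<open>The product of a polynomial with \<open>\<phi>\<close> lies in \<open>smooth_alg\<close>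
  and has bounded support, so \<open>dual\<close> applies directly.\<close>

lemma admissible_polynomial:
  assumes "real_polynomial_function f"
  shows "admissible f"
proof -
  have f: "smooth_alg f" by (rule smooth_alg_polynomial[OF assms])
  have "bounded (f ` K)"
    by (intro compact_imp_bounded compact_continuous_image K continuous_on_smooth_alg f)
  then obtain B where "\<And>x. x \<in> K \<Longrightarrow> \<bar>f x\<bar> \<le> B"
    by (auto simp: bounded_iff)
  then have B: "\<And>x. \<phi> x \<noteq> 0 \<Longrightarrow> \<bar>f x\<bar> \<le> max 0 B"
    using K(2) by fastforce
  have meas: "f \<in> borel_measurable lebesgue"
    by (intro borel_measurable_lebesgue_continuous continuous_on_smooth_alg f)
  have bd: "bounded {x. f x * \<phi> x \<noteq> 0}"
    by (rule bounded_subset[OF bounded_supp]) auto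
  show ?thesis
    unfolding admissible_def
    by (intro dual smooth_alg.mult f cutoff bd weighted_integrable(2)[OF meas B]) auto
qed

text \<open>Stone-Weierstrass on the compact \<open>K\<close>, which contains every point where
  \<open>\<phi>\<close> is non-zero. An approximation error below 1 keeps the polynomials uniformly
  bounded there.\<close>

lemma admissible_continuous:
  assumes f: "continuous_on UNIV f"
  shows "admissible f"
proof -
  have f_meas: "f \<in> borel_measurable lebesgue"
    by (rule borel_measurable_lebesgue_continuous[OF f])
  have "\<exists>g. polynomial_function g \<and> (\<forall>x\<in>K. norm (f x - g x) < inverse (real (Suc k)))" for k
    using f by (intro Stone_Weierstrass_polynomial_function K) (auto intro: continuous_on_subset)
  then obtain g where g: "\<And>k. real_polynomial_function (g k)"
    "\<And>k x. x \<in> K \<Longrightarrow> \<bar>f x - g k x\<bar> < inverse (real (Suc k))"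
    unfolding real_polynomial_function_eq real_norm_def by metis
  have g_meas: "g k \<in> borel_measurable lebesgue" for k
    by (intro borel_measurable_lebesgue_continuous continuous_on_smooth_alg smooth_alg_polynomial g)
  have "bounded (f ` K)"
    using f by (intro compact_imp_bounded compact_continuous_image K) (auto intro: continuous_on_subset)
  then obtain B where B: "\<And>x. x \<in> K \<Longrightarrow> \<bar>f x\<bar> \<le> B"
    by (auto simp: bounded_iff)
  \<comment> \<open>The absolute value guards against a negative \<open>B\<close>, which is possible
    when \<open>K\<close> is empty.\<close>
  have le: "\<bar>g k x\<bar> \<le> \<bar>B\<bar> + 1" if "\<phi> x \<noteq> 0" for k x
  proof -
    have "inverse (real (Suc k)) \<le> 1" by (simp add: field_simps)
    then show ?thesis
      using g(2)[OF K(2)[OF that], of k] B[OF K(2)[OF that]] by linarith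
  qed
  have lim: "(\<lambda>k. g k x) \<longlonglongrightarrow> f x" if "x \<in> K" for x
  proof (rule LIM_zero_cancel, rule Lim_null_comparison)
    show "\<forall>\<^sub>F k in sequentially. norm (g k x - f x) \<le> inverse (real (Suc k))"
      using g(2)[OF that] by (intro always_eventually) (auto simp: abs_minus_commute less_imp_le)
  qed (rule LIMSEQ_inverse_real_of_nat)
  show ?thesis
    by (rule admissible_limit[of g, OF g_meas f_meas le]) (use lim K(2) g(1) admissible_polynomial in auto)
qed

text \<open>A Lebesgue measurable function is almost everywhere a limit of continuous ones; clipping
  these at \<open>B\<close> and \<open>- B\<close> keeps continuity and the limit and supplies the
  uniform bound.\<close>

lemma admissible_bounded:
  assumes f: "f \<in> borel_measurable lebesgue" and B: "\<And>x. \<bar>f x\<bar> \<le> B"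
  shows "admissible f"
proof -
  have B0: "0 \<le> B" using B[of undefined] by linarith
  obtain N g where N: "negligible N" and g: "\<And>k. continuous_on UNIV (g k)"
    and lim: "\<And>x. x \<notin> N \<Longrightarrow> (\<lambda>k. g k x) \<longlonglongrightarrow> f x"
    using lebesgue_measurable_imp_measurable_on[OF f, of UNIV] unfolding measurable_on_def by auto
  define h where "h = (\<lambda>k x. max (- B) (min B (g k x)))"
  have h: "continuous_on UNIV (h k)" for k
    unfolding h_def by (intro continuous_intros g)
  have h_meas: "h k \<in> borel_measurable lebesgue" for k
    by (rule borel_measurable_lebesgue_continuous[OF h])
  have h_le: "\<bar>h k x\<bar> \<le> B" for k x
    using B0 by (auto simp: h_def)
  have "(\<lambda>k. h k x) \<longlonglongrightarrow> f x" if "x \<notin> N" for x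
  proof -
    have "(\<lambda>k. h k x) \<longlonglongrightarrow> max (- B) (min B (f x))"
      unfolding h_def by (intro tendsto_intros lim that)
    also have "max (- B) (min B (f x)) = f x"
      using B[of x] by auto
    finally show ?thesis .
  qed
  moreover have "AE x in lebesgue. x \<notin> N"
    using N by (intro AE_not_in) (simp add: negligible_iff_null_sets)
  ultimately have "AE x in lebesgue. \<phi> x \<noteq> 0 \<longrightarrow> (\<lambda>k. h k x) \<longlonglongrightarrow> f x"
    by (auto elim: eventually_mono)
  then show ?thesis
    by (rule admissible_limit[of h, OF h_meas f h_le B0]) (use h admissible_continuous in auto)
qed

section \<open>Testing the dual bound with extremal functions\<close>

text \<open>Testing with the sign of \<open>J\<close> on the zero set of \<open>v\<close> makes the
  right-hand side vanish. This controls the set on which the negative power of the weight is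
  infinite.\<close>

lemma AE_zero_weight: "AE x in lebesgue. v x = 0 \<longrightarrow> \<phi> x = 0 \<or> J x = 0"
proof -
  define f where "f = (\<lambda>x. sgn (J x) * indicator {x. v x = 0} x)"
  have f [measurable]: "f \<in> borel_measurable lebesgue"
    unfolding f_def by measurable
  have f_le: "\<bar>f x\<bar> \<le> 1" for x
    by (auto simp: f_def abs_mult abs_sgn_eq split: split_indicator)
  have nonneg: "f x * \<phi> x * J x \<ge> 0" for x
    using cutoff(2)[of x] by (auto simp: f_def sgn_if mult_nonneg_nonpos split: split_indicator)
  have zero: "(\<lambda>x. \<bar>f x * \<phi> x\<bar> powr p * v x) = (\<lambda>_. 0)"
    by (auto simp: f_def fun_eq_iff split: split_indicator)
  have "admissible f" by (rule admissible_bounded[OF f f_le])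
  then have "(LINT x|lebesgue. f x * \<phi> x * J x) = 0"
    unfolding admissible_def zero by simp
  then have "AE x in lebesgue. f x * \<phi> x * J x = 0"
    using integral_nonneg_eq_0_iff_AE[OF weighted_integrable(1)[OF f f_le]] nonneg by simp
  then show ?thesis
    by (rule eventually_mono) (auto simp: f_def sgn_if split: if_splits)
qed

text \<open>The extremal function of the duality, truncated so that it is bounded.\<close>

lemma truncated_bound:
  assumes e: "0 < e"
  defines "A \<equiv> {x. e < v x \<and> e < \<phi> x}"
  shows "(\<integral>\<^sup>+x. ennreal (v x powr (1 - conj_exponent p) * \<bar>J x\<bar> powr conj_exponent p * indicator A x) \<partial>lebesgue)
    \<le> ennreal (D powr conj_exponent p)"
proof -
  define p' where "p' = conj_exponent p"
  have p': "1 < p'" "p * (p' - 1) = p'" "p * (1 - p') = - p'" "1 - 1 / p = 1 / p'"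
    using p by (auto simp: p'_def conj_exponent_def field_simps)
  have "{x \<in> space lebesgue. e < v x \<and> e < \<phi> x} \<in> sets lebesgue" by measurable
  then have [measurable]: "A \<in> sets lebesgue" by (simp add: A_def)
  \<comment> \<open>Dividing by \<open>\<phi>\<close> undoes the cutoff, so that
    \<open>f * \<phi>\<close> is the Hoelder extremal function on \<open>A\<close>. There
    \<open>v\<close> and \<open>\<phi>\<close> both exceed \<open>e\<close>, hence \<open>f\<close>
    is bounded. By the relations in \<open>p'\<close>, the integrands on the two sides of the dual
    bound are both \<open>F\<close>.\<close>
  define f where "f = (\<lambda>x. sgn (J x) * \<bar>J x\<bar> powr (p' - 1) * v x powr (1 - p') * indicator A x / \<phi> x)"
  define F where "F = (\<lambda>x. v x powr (1 - p') * \<bar>J x\<bar> powr p' * indicator A x)"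
  have f [measurable]: "f \<in> borel_measurable lebesgue"
    unfolding f_def by measurable
  have f_le: "\<bar>f x\<bar> \<le> e powr (1 - p') / e" for x
  proof (cases "x \<in> A")
    case True
    then have vx: "e < v x" "e < \<phi> x" by (auto simp: A_def)
    have "\<bar>sgn (J x)\<bar> * \<bar>J x\<bar> powr (p' - 1) \<le> 1 * 1"
      using J_le[of x] p' by (intro mult_mono powr_le1) (auto simp: abs_sgn_eq)
    moreover have "v x powr (1 - p') \<le> e powr (1 - p')"
      using vx e p' by (intro powr_mono2') auto
    ultimately have "\<bar>sgn (J x)\<bar> * \<bar>J x\<bar> powr (p' - 1) * v x powr (1 - p') \<le> 1 * e powr (1 - p')"
      by (intro mult_mono) auto
    then have "\<bar>sgn (J x)\<bar> * \<bar>J x\<bar> powr (p' - 1) * v x powr (1 - p') / \<phi> x \<le> e powr (1 - p') / e"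
      using vx e by (intro frac_le) auto
    then show ?thesis
      using True vx e by (simp add: f_def abs_mult)
  qed (use e in \<open>simp add: f_def\<close>)
  have F1: "f x * \<phi> x * J x = F x" for x
  proof (cases "x \<in> A")
    case True
    have "sgn (J x) * \<bar>J x\<bar> powr (p' - 1) * J x = \<bar>J x\<bar> powr p'"
    proof (cases "J x = 0")
      case False
      have "sgn (J x) * \<bar>J x\<bar> powr (p' - 1) * J x = \<bar>J x\<bar> powr (p' - 1) * (sgn (J x) * J x)"
        by (simp only: mult_ac)
      also have "sgn (J x) * J x = \<bar>J x\<bar>" by (simp add: sgn_if)
      also have "\<bar>J x\<bar> powr (p' - 1) * \<bar>J x\<bar> = \<bar>J x\<bar> powr p'"
        using False powr_add[of "\<bar>J x\<bar>" "p' - 1" 1] by simp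
      finally show ?thesis .
    qed simp
    moreover have "\<phi> x \<noteq> 0" using True e by (auto simp: A_def)
    ultimately show ?thesis using True by (simp add: f_def F_def mult_ac)
  qed (simp add: f_def F_def)
  have F2: "\<bar>f x * \<phi> x\<bar> powr p * v x = F x" for x
  proof (cases "x \<in> A")
    case True
    then have vx: "0 < v x" "0 < \<phi> x" using e by (auto simp: A_def)
    have "\<bar>f x * \<phi> x\<bar> = \<bar>J x\<bar> powr (p' - 1) * v x powr (1 - p')"
      using True vx p' by (cases "J x = 0") (auto simp: f_def abs_mult abs_sgn_eq)
    then have "\<bar>f x * \<phi> x\<bar> powr p = \<bar>J x\<bar> powr p' * v x powr (- p')"
      using p' vx by (simp add: powr_mult powr_powr mult.commute[of _ p])
    moreover have "v x powr (- p') * v x = v x powr (1 - p')"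
      using vx powr_add[of "v x" "- p'" 1] by simp
    ultimately show ?thesis using True by (simp add: F_def mult_ac)
  qed (simp add: f_def F_def)
  define I where "I = (LINT x|lebesgue. F x)"
  have F_nonneg: "0 \<le> F x" for x by (simp add: F_def)
  have int: "integrable lebesgue F"
    using weighted_integrable(1)[OF f f_le] e unfolding F1 by simp
  have I: "0 \<le> I" unfolding I_def by (simp add: F_nonneg)
  have "admissible f" by (rule admissible_bounded[OF f f_le])
  then have le: "I \<le> D * I powr (1 / p)"
    using I unfolding admissible_def F1 F2 I_def[symmetric] by simp
  \<comment> \<open>\<open>I\<close> is a finite real by the truncation, so a positive
    \<open>I powr (1 / p)\<close> can be cancelled from \<open>le\<close>. The resulting bound does
    not depend on \<open>e\<close>.\<close>
  have "I \<le> D powr p'"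
  proof (cases "I = 0")
    case False
    with I have I: "0 < I" by simp
    have "I = I powr (1 / p') * I powr (1 / p)"
      using I p'(4) by (simp flip: powr_add) (simp flip: p'(4))
    with le have "I powr (1 / p') * I powr (1 / p) \<le> D * I powr (1 / p)" by simp
    then have "I powr (1 / p') \<le> D" using I by simp
    then have "(I powr (1 / p')) powr p' \<le> D powr p'"
      using p' by (intro powr_mono2) auto
    then show ?thesis using I p' by (simp add: powr_powr)
  qed simp
  moreover have "(\<integral>\<^sup>+x. ennreal (F x) \<partial>lebesgue) = ennreal I"
    using int F_nonneg by (simp add: nn_integral_eq_integral I_def)
  ultimately show ?thesis
    unfolding F_def p'_def[symmetric] by (simp add: ennreal_leI)
qed

end

section \<open>Covering almost all of space and passing to the limit\<close>

text \<open>By Lindelof, countably many of the open balls on which \<open>v\<close> is integrable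
  already cover the union of all of them, which contains almost every point.\<close>

lemma locally_integrable_cover:
  fixes v :: "'a::euclidean_space \<Rightarrow> real"
  assumes "AE x in lebesgue. \<exists>r>0. (\<integral>\<^sup>+ y \<in> ball x r. ennreal (v y) \<partial>lebesgue) < \<infinity>"
  obtains a :: "nat \<Rightarrow> 'a" and r :: "nat \<Rightarrow> real" where "\<And>i. 0 \<le> r i"
    "\<And>i. (\<integral>\<^sup>+ y \<in> ball (a i) (r i). ennreal (v y) \<partial>lebesgue) < \<infinity>"
    "AE x in lebesgue. \<exists>i. x \<in> ball (a i) (r i)"
proof -
  define G where "G = {(x, r). 0 \<le> r \<and> (\<integral>\<^sup>+ y \<in> ball x r. ennreal (v y) \<partial>lebesgue) < \<infinity>}"
  define F where "F = (\<lambda>(x, r). ball x r) ` G"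
  have zero: "(0, 0) \<in> G" by (simp add: G_def)
  have zero_ball: "ball 0 0 \<in> F"
    using imageI[OF zero, of "\<lambda>(x, r). ball x r"] by (simp add: F_def)
  have op: "open S" if "S \<in> F" for S using that by (auto simp: F_def)
  obtain F' where F': "F' \<subseteq> F" "countable F'" "\<Union>F' = \<Union>F"
    using Lindelof[OF op] by blast
  define F'' where "F'' = insert (ball 0 0) F'"
  have F'': "F'' \<subseteq> F" "countable F''" "\<Union>F'' = \<Union>F" "F'' \<noteq> {}"
    using F' zero_ball by (auto simp: F''_def)
  define b where "b = from_nat_into F''"
  have b: "range b = F''"
    using F'' by (simp add: b_def range_from_nat_into)
  have "\<exists>z\<in>G. b i = (\<lambda>(x, r). ball x r) z" for i
  proof -
    have "b i \<in> F" using b F''(1) by blast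
    then show ?thesis by (auto simp: F_def)
  qed
  then obtain z where z: "\<And>i. z i \<in> G" "\<And>i. b i = (\<lambda>(x, r). ball x r) (z i)" by metis
  show thesis
  proof (rule that[of "\<lambda>i. snd (z i)" "\<lambda>i. fst (z i)"])
    show "0 \<le> snd (z i)" and "(\<integral>\<^sup>+ y \<in> ball (fst (z i)) (snd (z i)). ennreal (v y) \<partial>lebesgue) < \<infinity>" for i
      using z(1)[of i] by (auto simp: G_def)
    show "AE x in lebesgue. \<exists>i. x \<in> ball (fst (z i)) (snd (z i))"
      using assms
    proof eventually_elim
      case (elim x)
      then obtain r where r: "0 < r" "(\<integral>\<^sup>+ y \<in> ball x r. ennreal (v y) \<partial>lebesgue) < \<infinity>" by blast
      then have "(x, r) \<in> G" by (simp add: G_def)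
      from imageI[OF this, of "\<lambda>(x, r). ball x r"] have "ball x r \<in> F" by (simp add: F_def)
      then have "x \<in> \<Union>F" using r(1) by (metis UnionI centre_in_ball)
      then have "\<exists>i. x \<in> b i" using F''(3) b by blast
      then show ?case using z(2) by (auto simp: case_prod_beta)
    qed
  qed
qed

theorem proposition2p2:
  fixes p q C :: real
    and U v :: "real ^ 'n \<Rightarrow> real"
  assumes "CARD('n) \<ge> 2" and "1 < p" and "1 < q"
    and "U \<in> borel_measurable sphere_measure" and "\<And>\<omega>. \<omega> \<in> sphere 0 1 \<Longrightarrow> 0 \<le> U \<omega>"
    and "v \<in> borel_measurable lebesgue" and "\<And>x. 0 \<le> v x"
    and "AE x in lebesgue. \<exists>r>0. (\<integral>\<^sup>+ y \<in> ball x r. ennreal (v y) \<partial>lebesgue) < \<infinity>"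
    and "0 < C"
    and "\<And>f. f \<in> test_functions \<Longrightarrow>
           (\<integral>\<^sup>+ \<omega>. ennreal (norm (fourier f \<omega>) powr q * U \<omega>) \<partial>sphere_measure) epowr (1 / q)
           \<le> ennreal C * (\<integral>\<^sup>+ x. ennreal (norm (f x) powr p * v x) \<partial>lebesgue) epowr (1 / p)"
    and "(\<integral>\<^sup>+ \<omega>. ennreal (U \<omega>) epowr (1 - conj_exponent q) \<partial>sphere_measure) < \<infinity>"
  shows "(\<integral>\<^sup>+ x. ennreal (v x) epowr (1 - conj_exponent p)
            * ennreal (\<bar>bessel_j (real CARD('n) / 2 - 1) (norm x)\<bar> powr conj_exponent p) \<partial>lebesgue) < \<infinity>"
proof -
  let ?J = "sphere_bessel :: real ^ 'n \<Rightarrow> real"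
  note p = \<open>1 < p\<close> and v_nonneg = \<open>\<And>x. 0 \<le> v x\<close>
  note [measurable] = \<open>v \<in> borel_measurable lebesgue\<close>
  define p' where "p' = conj_exponent p"
  have p': "1 < p'" using p by (simp add: p'_def conj_exponent_def field_simps)
  have dim: "2 \<le> DIM(real ^ 'n)" using assms(1) by simp
  have J [measurable]: "?J \<in> borel_measurable lebesgue"
    by (rule measurable_completion) (simp add: borel_measurable_sphere_bessel[OF dim])
  obtain D where D: "0 \<le> D" and dual: "\<And>f. smooth_alg f \<Longrightarrow> bounded {x. f x \<noteq> 0} \<Longrightarrow>
      integrable lebesgue (\<lambda>x. \<bar>f x\<bar> powr p * v x) \<Longrightarrow>
      \<bar>LINT x|lebesgue. f x * ?J x\<bar> \<le> D * (LINT x|lebesgue. \<bar>f x\<bar> powr p * v x) powr (1 / p)"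
    using restriction_duality[OF dim assms(2-7,9-11)] by blast
  obtain a :: "nat \<Rightarrow> real ^ 'n" and r where r: "\<And>i. 0 \<le> r i"
    and fin: "\<And>i. (\<integral>\<^sup>+ y \<in> ball (a i) (r i). ennreal (v y) \<partial>lebesgue) < \<infinity>"
    and cover: "AE x in lebesgue. \<exists>i. x \<in> ball (a i) (r i)"
    by (rule locally_integrable_cover[OF assms(8)]) (rule that)
  \<comment> \<open>\<open>b i\<close> is a bump with values in the unit interval that is positive
    exactly on the \<open>i\<close>-th ball. The partial sums \<open>\<phi> m\<close> increase with
    \<open>m\<close>, are at most \<open>m\<close>, and eventually become positive at every covered
    point.\<close>
  define b where "b = (\<lambda>i x. flat 0 ((r i)\<^sup>2 - (x - a i) \<bullet> (x - a i)))"
  define \<phi> where "\<phi> = (\<lambda>m x. \<Sum>i<m. b i x)"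
  have b_nonneg: "0 \<le> b i x" for i x by (simp add: b_def flat_nonneg)
  have b_le: "b i x \<le> indicator (ball (a i) (r i)) x" for i x
  proof (cases "x \<in> ball (a i) (r i)")
    case True
    then show ?thesis by (simp add: b_def flat_def)
  next
    case False
    then have "(r i)\<^sup>2 \<le> (norm (x - a i))\<^sup>2"
      using r by (intro power_mono) (auto simp: dist_norm norm_minus_commute)
    then show ?thesis
      using False by (simp add: b_def flat_def power2_norm_eq_inner)
  qed
  have b_pos: "0 < b i x" if "x \<in> ball (a i) (r i)" for i x
  proof -
    have "(norm (x - a i))\<^sup>2 < (r i)\<^sup>2"
      using that by (intro power_strict_mono) (auto simp: dist_norm norm_minus_commute)
    then show ?thesis
      by (simp add: b_def flat_pos_iff power2_norm_eq_inner)
  qed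
  have \<phi>_smooth: "smooth_alg (\<phi> m)" for m
    unfolding \<phi>_def b_def by (intro smooth_alg_sum smooth_alg.flat)
  have \<phi>_nonneg: "0 \<le> \<phi> m x" for m x
    by (simp add: \<phi>_def sum_nonneg b_nonneg)
  have \<phi>_mono: "\<phi> k x \<le> \<phi> m x" if "k \<le> m" for k m x
    unfolding \<phi>_def using that by (intro sum_mono2) (auto simp: b_nonneg)
  have \<phi>_le: "\<phi> m x \<le> real m * indicator (\<Union>i<m. ball (a i) (r i)) x" for m x
  proof -
    have "\<phi> m x \<le> (\<Sum>i<m. indicator (\<Union>i<m. ball (a i) (r i)) x)"
      unfolding \<phi>_def using b_le by (intro sum_mono order_trans[OF b_le]) (auto split: split_indicator)
    then show ?thesis by simp
  qed
  have dual_m: "cutoff_dual p D v ?J (\<phi> m) (\<Union>i<m. cball (a i) (r i))" for m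
  proof
    let ?B = "\<Union>i<m. ball (a i) (r i)"
    show "x \<in> (\<Union>i<m. cball (a i) (r i))" if "\<phi> m x \<noteq> 0" for x
    proof -
      have "x \<in> ?B" using \<phi>_le[of m x] \<phi>_nonneg[of m x] that by (auto split: split_indicator_asm)
      then show ?thesis by force
    qed
    have "integrable lebesgue (\<lambda>x. indicator (ball (a i) (r i)) x * v x)" for i
    proof (rule integrableI_bounded)
      show "(\<lambda>x. indicator (ball (a i) (r i)) x * v x) \<in> borel_measurable lebesgue"
        by (intro borel_measurable_times borel_measurable_indicator assms(6)) simp
      have "(\<integral>\<^sup>+x. ennreal (norm (indicator (ball (a i) (r i)) x * v x)) \<partial>lebesgue) =
          (\<integral>\<^sup>+ y \<in> ball (a i) (r i). ennreal (v y) \<partial>lebesgue)"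
        using v_nonneg by (intro nn_integral_cong) (auto split: split_indicator)
      also have "\<dots> < \<infinity>" by (rule fin)
      finally show "(\<integral>\<^sup>+x. ennreal (norm (indicator (ball (a i) (r i)) x * v x)) \<partial>lebesgue) < \<infinity>" .
    qed
    then have B_int: "integrable lebesgue (\<lambda>x. (\<Sum>i<m. indicator (ball (a i) (r i)) x * v x))"
      by (intro Bochner_Integration.integrable_sum)
    have [measurable]: "\<phi> m \<in> borel_measurable lebesgue"
      by (intro borel_measurable_lebesgue_continuous continuous_on_smooth_alg \<phi>_smooth)
    show "integrable lebesgue (\<lambda>x. \<phi> m x powr p * v x)"
    proof (rule Bochner_Integration.integrable_bound[OF integrable_mult_right[OF B_int, of "real m powr p"]])
      \<comment> \<open>On the finite union the cutoff is at most \<open>m\<close>, and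
        \<open>v\<close> is at most the sum of its restrictions to the balls, each of which is
        integrable.\<close>
      have "\<phi> m x powr p * v x \<le> real m powr p * (\<Sum>i<m. indicator (ball (a i) (r i)) x * v x)" for x
      proof (cases "x \<in> ?B")
        case True
        then obtain i where i: "i < m" "x \<in> ball (a i) (r i)" by auto
        have "\<phi> m x powr p \<le> real m powr p"
          using \<phi>_le[of m x] \<phi>_nonneg[of m x] True p by (intro powr_mono2) auto
        moreover have "indicator (ball (a i) (r i)) x * v x \<le> (\<Sum>i<m. indicator (ball (a i) (r i)) x * v x)"
          using i v_nonneg by (intro member_le_sum) auto
        then have "v x \<le> (\<Sum>i<m. indicator (ball (a i) (r i)) x * v x)"
          using i(2) by (simp only: indicator_simps mult_1)
        ultimately show ?thesis using v_nonneg by (intro mult_mono) auto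
      next
        case False
        then have "\<phi> m x = 0" using \<phi>_le[of m x] \<phi>_nonneg[of m x] by simp
        then show ?thesis using v_nonneg by (auto intro!: mult_nonneg_nonneg sum_nonneg)
      qed
      then show "AE x in lebesgue. norm (\<phi> m x powr p * v x) \<le>
          norm (real m powr p * (\<Sum>i<m. indicator (ball (a i) (r i)) x * v x))"
        using v_nonneg by (intro AE_I2) (simp add: abs_mult sum_nonneg)
    qed measurable
  qed (use p D v_nonneg abs_sphere_bessel_le_1[OF dim] \<phi>_smooth \<phi>_nonneg dual
        in \<open>auto intro!: compact_UN\<close>)
  \<comment> \<open>One index drives both the cutoff and the truncation level; \<open>Suc\<close>
    keeps the level finite at \<open>m = 0\<close>. The bound on the integrals is uniform in
    \<open>m\<close>, which prepares for Fatou's lemma.\<close>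
  define u where "u = (\<lambda>m x. ennreal (v x powr (1 - p') * \<bar>?J x\<bar> powr p' *
    indicator {x. 1 / real (Suc m) < v x \<and> 1 / real (Suc m) < \<phi> m x} x))"
  have u_le: "(\<integral>\<^sup>+x. u m x \<partial>lebesgue) \<le> ennreal (D powr p')" for m
    using cutoff_dual.truncated_bound[OF dual_m, of "1 / real (Suc m)" m]
    by (simp add: u_def p'_def)
  have u_meas: "u m \<in> borel_measurable lebesgue" for m
  proof -
    have [measurable]: "\<phi> m \<in> borel_measurable lebesgue"
      by (intro borel_measurable_lebesgue_continuous continuous_on_smooth_alg \<phi>_smooth)
    have "{x \<in> space lebesgue. 1 / real (Suc m) < v x \<and> 1 / real (Suc m) < \<phi> m x} \<in> sets lebesgue"
      by measurable
    then have [measurable]: "{x. 1 / real (Suc m) < v x \<and> 1 / real (Suc m) < \<phi> m x} \<in> sets lebesgue"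
      by simp
    show ?thesis unfolding u_def by measurable
  qed
  have "AE x in lebesgue. \<forall>m. v x = 0 \<longrightarrow> \<phi> m x = 0 \<or> ?J x = 0"
    unfolding AE_all_countable by (intro allI cutoff_dual.AE_zero_weight[OF dual_m])
  with cover have "AE x in lebesgue. ennreal (v x) epowr (1 - p') * ennreal (\<bar>?J x\<bar> powr p') \<le> liminf (\<lambda>m. u m x)"
  proof eventually_elim
    case (elim x)
    then obtain i where "x \<in> ball (a i) (r i)" by blast
    then have pos: "0 < \<phi> (Suc i) x"
      unfolding \<phi>_def using b_pos b_nonneg by (simp add: add_nonneg_pos sum_nonneg)
    show ?case
    proof (cases "v x = 0")
      case True
      \<comment> \<open>The power of \<open>v x\<close> is infinite here, but in
        \<open>ennreal\<close> its product with 0 is 0.\<close>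
      then have "?J x = 0" using elim(2) pos by fastforce
      then show ?thesis by simp
    next
      case False
      with v_nonneg[of x] have vx: "0 < v x" by simp
      have "\<forall>\<^sub>F m in sequentially. 1 / real (Suc m) < min (v x) (\<phi> (Suc i) x)"
        using vx pos order_tendstoD(2)[OF LIMSEQ_inverse_real_of_nat, of "min (v x) (\<phi> (Suc i) x)"]
        by (simp add: inverse_eq_divide)
      with eventually_ge_at_top[of "Suc i"]
      \<comment> \<open>Monotonicity of the cutoffs keeps \<open>\<phi> m x\<close> above the
        shrinking level, so the truncation is eventually inactive at \<open>x\<close>.\<close>
      have "\<forall>\<^sub>F m in sequentially. u m x = ennreal (v x) epowr (1 - p') * ennreal (\<bar>?J x\<bar> powr p')"
      proof eventually_elim
        case (elim m)
        then have "1 / real (Suc m) < v x" "1 / real (Suc m) < \<phi> m x"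
          using \<phi>_mono[of "Suc i" m x] by auto
        then show ?case
          using vx p' by (simp add: u_def epowr_def ennreal_mult)
      qed
      then have "(\<lambda>m. u m x) \<longlonglongrightarrow> ennreal (v x) epowr (1 - p') * ennreal (\<bar>?J x\<bar> powr p')"
        by (rule tendsto_eventually)
      then show ?thesis
        by (simp add: lim_imp_Liminf)
    qed
  qed
  then have "(\<integral>\<^sup>+x. ennreal (v x) epowr (1 - p') * ennreal (\<bar>?J x\<bar> powr p') \<partial>lebesgue) \<le>
      (\<integral>\<^sup>+x. liminf (\<lambda>m. u m x) \<partial>lebesgue)"
    by (rule nn_integral_mono_AE)
  also have "\<dots> \<le> liminf (\<lambda>m. \<integral>\<^sup>+x. u m x \<partial>lebesgue)"
    by (rule nn_integral_liminf[OF u_meas])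
  also have "\<dots> \<le> ennreal (D powr p')"
    using u_le by (intro Liminf_le) auto
  also have "\<dots> < \<infinity>" by simp
  finally show ?thesis
    by (simp add: sphere_bessel_def p'_def)
qed

end
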